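(* Let $X$ be a (finite abstract) simplicial complex and let $D\ge1$ be an integer. Then \[ \beta_{D-1}(X) \le \sum_{\tau \in X_{D-2}} \gamma\bigl(\mathrm{lk}_X(\tau)^{(1)};\,1-D^{-1}\bigr). \]
   Context: A simplicial complex $X$ on a nonempty finite set $V$ is a collection of nonempty subsets of $V$ containing all singletons and closed under taking nonempty subsets. $X_k$ is the set of $\sigma\in X$ with $\#\sigma=k+1$ ($k$-simplices), and $X_{-1}=\{\emptyset\}$. $X^{(1)}=X_0\sqcup X_1$ is the one-dimensional skeleton, regarded as a graph. $\beta_k(X)$ is the $k$-th reduced Betti number over $\mathbb{R}$ (homology of the augmented chain complex with $C_{-1}(X)=\mathbb{R}$). For $\tau\in X_j$ ($j\ge -1$), the link is $\mathrm{lk}_X(\tau)=\{\sigma\in X: \tau\cap\sigma=\emptyset,\ \tau\cup\sigma\in X\}$, which is either empty or a simplicial complex; $\mathrm{lk}_X(\emptyset)=X$. For a finite simple graph $G$ on vertex set $V$, the averaging matrix $A[G]=(a_{vw})_{v,w\in V}$ has $a_{vw}=1/\deg(v)$ if $w$ is adjacent to $v$, $a_{vv}=1$ if $v$ is isolated, and $a_{vw}=0$ otherwise; $\mathcal{L}[G]=I_V-A[G]$, whose eigenvalues $\lambda_1,\dots,\lambda_{\#V}$ (with multiplicity) are real and lie in $[0,2]$. For $\alpha\ge0$, $\gamma(G;\alpha)=\#\{i:\lambda_i\le\alpha\}-1$, and $\gamma(\emptyset;\alpha)=0$. *)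

theory Defs
  imports
    Complex_Main
    "HOL-Library.Function_Algebras"
    "Jordan_Normal_Form.Char_Poly"
begin

section \<open>Simplicial complexes\<close>

definition simplicial_complex :: "'a set \<Rightarrow> 'a set set \<Rightarrow> bool" where
  "simplicial_complex V X \<longleftrightarrow>
     finite V \<and> V \<noteq> {} \<and>
     (\<forall>\<sigma>\<in>X. \<sigma> \<noteq> {} \<and> \<sigma> \<subseteq> V) \<and>
     (\<forall>v\<in>V. {v} \<in> X) \<and>
     (\<forall>\<sigma>\<in>X. \<forall>\<tau>. \<tau> \<noteq> {} \<and> \<tau> \<subseteq> \<sigma> \<longrightarrow> \<tau> \<in> X)"

text \<open>The empty set is not a member of \<open>X\<close>; it is the unique simplex of dimension \<open>-1\<close>
  by convention.\<close>

definition simplices :: "'a set set \<Rightarrow> int \<Rightarrow> 'a set set" where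
  "simplices X k = (if k = -1 then {{}} else {\<sigma> \<in> X. int (card \<sigma>) = k + 1})"

definition link :: "'a set set \<Rightarrow> 'a set \<Rightarrow> 'a set set" where
  "link X \<tau> = {\<sigma> \<in> X. \<tau> \<inter> \<sigma> = {} \<and> \<tau> \<union> \<sigma> \<in> X}"

section \<open>Reduced Betti numbers\<close>

text \<open>Pointwise scalar multiplication, so that \<^const>\<open>real_vector.dim\<close> applies to spaces of
  real functions.\<close>

instantiation "fun" :: (type, real_vector) real_vector
begin

definition scaleR_fun :: "real \<Rightarrow> ('a \<Rightarrow> 'b) \<Rightarrow> 'a \<Rightarrow> 'b" where
  "scaleR_fun r f = (\<lambda>x. r *\<^sub>R f x)"

instance
  by standard (auto simp: scaleR_fun_def plus_fun_def scaleR_add_right scaleR_add_left)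

end

text \<open>A \<open>k\<close>-chain is an alternating function \<open>c\<close> on orderings of \<open>k\<close>-simplices:
  \<open>c [v\<^sub>0, \<dots>, v\<^sub>k]\<close> is the coefficient in the chain of the oriented simplex
  \<open>[v\<^sub>0, \<dots>, v\<^sub>k]\<close>, and exchanging two vertices reverses the orientation. This needs no choice of
  an ordering of the vertices. In dimension \<open>-1\<close> the only ordering is the empty list, so
  \<open>simplicial_chains X (-1)\<close> is a copy of the real numbers.\<close>

definition simplicial_chains :: "'a set set \<Rightarrow> int \<Rightarrow> ('a list \<Rightarrow> real) set" where
  "simplicial_chains X k = {c.
     (\<forall>vs. c vs \<noteq> 0 \<longrightarrow> distinct vs \<and> set vs \<in> simplices X k) \<and>
     (\<forall>vs i j. i < j \<and> j < length vs \<longrightarrow> c (vs[i := vs ! j, j := vs ! i]) = - c vs)}"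

text \<open>The usual boundary \<open>[v\<^sub>0, \<dots>, v\<^sub>k] \<mapsto> \<Sum>i. (-1)\<^sup>i [v\<^sub>0, \<dots>, v\<^sub>i\<^sub>-\<^sub>1, v\<^sub>i\<^sub>+\<^sub>1, \<dots>, v\<^sub>k]\<close>,
  expressed on coefficients: \<open>[u\<^sub>0, \<dots>, u\<^sub>k\<^sub>-\<^sub>1]\<close> occurs with coefficient \<open>1\<close> in the boundary of
  each \<open>[v, u\<^sub>0, \<dots>, u\<^sub>k\<^sub>-\<^sub>1]\<close>. On \<open>0\<close>-chains it is the augmentation, the sum of the
  coefficients, and on \<open>simplicial_chains X (-1)\<close> it is zero.\<close>

definition simplicial_boundary :: "'a set set \<Rightarrow> ('a list \<Rightarrow> real) \<Rightarrow> 'a list \<Rightarrow> real" where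
  "simplicial_boundary X c = (\<lambda>vs. \<Sum>v\<in>\<Union>X. c (v # vs))"

definition simplicial_cycles :: "'a set set \<Rightarrow> int \<Rightarrow> ('a list \<Rightarrow> real) set" where
  "simplicial_cycles X k = {c \<in> simplicial_chains X k. simplicial_boundary X c = 0}"

definition simplicial_boundaries :: "'a set set \<Rightarrow> int \<Rightarrow> ('a list \<Rightarrow> real) set" where
  "simplicial_boundaries X k = simplicial_boundary X ` simplicial_chains X (k + 1)"

definition betti :: "'a set set \<Rightarrow> int \<Rightarrow> int" where
  "betti X k = int (real_vector.dim (simplicial_cycles X k)) - int (real_vector.dim (simplicial_boundaries X k))"

text \<open>The difference is the dimension of the quotient space of cycles modulo boundaries.\<close>

lemma boundaries_subset_cycles:
  assumes "simplicial_complex V X" and "k \<ge> -1"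
  shows "simplicial_boundaries X k \<subseteq> simplicial_cycles X k"
proof
  fix b assume "b \<in> simplicial_boundaries X k"
  then obtain c where c: "c \<in> simplicial_chains X (k + 1)" and b: "b = simplicial_boundary X c"
    by (auto simp: simplicial_boundaries_def)
  have supp: "distinct vs \<and> set vs \<in> simplices X (k + 1)" if "c vs \<noteq> 0" for vs
    using c that by (auto simp: simplicial_chains_def)
  have alt: "c (vs[i := vs ! j, j := vs ! i]) = - c vs" if "i < j" "j < length vs" for vs i j
    using c that by (auto simp: simplicial_chains_def)
  have "distinct vs \<and> set vs \<in> simplices X k" if nz: "b vs \<noteq> 0" for vs
  proof -
    from nz obtain v where "c (v # vs) \<noteq> 0"
      unfolding b simplicial_boundary_def by (meson sum.neutral)
    with supp have d: "distinct (v # vs)" and s: "set (v # vs) \<in> simplices X (k + 1)"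
      by blast+
    have mem: "set (v # vs) \<in> X" and len: "int (length vs) = k + 1"
      using s d assms(2) by (auto simp: simplices_def distinct_card split: if_splits)
    have "set vs \<in> X" if "vs \<noteq> []"
      using mem that assms(1) unfolding simplicial_complex_def
      by (metis list.set_intros(2) set_empty subsetI)
    moreover have "vs = [] \<longleftrightarrow> k = -1"
      using len by auto
    ultimately show ?thesis
      using d len by (auto simp: simplices_def distinct_card)
  qed
  moreover have "b (vs[i := vs ! j, j := vs ! i]) = - b vs"
    if "i < j" "j < length vs" for vs i j
    unfolding b simplicial_boundary_def sum_negf[symmetric]
    using alt[of "Suc i" "Suc j" "_ # vs"] that by simp
  ultimately have "b \<in> simplicial_chains X k"
    by (auto simp: simplicial_chains_def)
  moreover have "simplicial_boundary X b = 0"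
  proof
    fix vs
    have swap: "c (v # w # vs) = - c (w # v # vs)" for v w
      using alt[of 0 1 "w # v # vs"] by simp
    have "simplicial_boundary X b vs = (\<Sum>v\<in>\<Union>X. \<Sum>w\<in>\<Union>X. c (w # v # vs))"
      by (simp add: b simplicial_boundary_def)
    also have "\<dots> = (\<Sum>w\<in>\<Union>X. \<Sum>v\<in>\<Union>X. c (w # v # vs))"
      by (rule sum.swap)
    also have "\<dots> = - (\<Sum>w\<in>\<Union>X. \<Sum>v\<in>\<Union>X. c (v # w # vs))"
      by (subst swap) (simp add: sum_negf)
    also have "\<dots> = - simplicial_boundary X b vs"
      by (simp add: b simplicial_boundary_def)
    finally show "simplicial_boundary X b vs = 0 vs" by simp
  qed
  ultimately show "b \<in> simplicial_cycles X k"
    by (simp add: simplicial_cycles_def)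
qed

section \<open>Graphs and their averaging matrices\<close>

text \<open>A graph is a pair of a finite vertex set and a set of two-element subsets of it.\<close>

definition skeleton1 :: "'a set set \<Rightarrow> 'a set \<times> 'a set set" where
  "skeleton1 X = (\<Union> (simplices X 0), simplices X 1)"

definition graph_degree :: "'a set \<times> 'a set set \<Rightarrow> 'a \<Rightarrow> nat" where
  "graph_degree G v = card {w \<in> fst G. {v, w} \<in> snd G}"

definition averaging_entry :: "'a set \<times> 'a set set \<Rightarrow> 'a \<Rightarrow> 'a \<Rightarrow> real" where
  "averaging_entry G v w =
     (if {v, w} \<in> snd G then 1 / real (graph_degree G v)
      else if v = w \<and> graph_degree G v = 0 then 1
      else 0)"

text \<open>Matrices are indexed by natural numbers, so the vertices are enumerated in an arbitrary
  order; the characteristic polynomial does not depend on it.\<close>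

definition vertex_list :: "'a set \<times> 'a set set \<Rightarrow> 'a list" where
  "vertex_list G = (SOME vs. distinct vs \<and> set vs = fst G)"

definition averaging_matrix :: "'a set \<times> 'a set set \<Rightarrow> real mat" where
  "averaging_matrix G =
     (let n = card (fst G)
      in mat n n (\<lambda>(i, j). averaging_entry G (vertex_list G ! i) (vertex_list G ! j)))"

definition laplacian :: "'a set \<times> 'a set set \<Rightarrow> real mat" where
  "laplacian G = 1\<^sub>m (card (fst G)) - averaging_matrix G"

text \<open>All eigenvalues of the Laplacian are real, so this multiset has \<open>card (fst G)\<close> members.\<close>

definition laplacian_eigenvalues :: "'a set \<times> 'a set set \<Rightarrow> real multiset" where
  "laplacian_eigenvalues G = proots (char_poly (laplacian G))"

definition gamma :: "'a set \<times> 'a set set \<Rightarrow> real \<Rightarrow> int" where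
  "gamma G \<alpha> =
     (if fst G = {} then 0
      else int (size {# l \<in># laplacian_eigenvalues G. l \<le> \<alpha> #}) - 1)"

end

theory Submission
  imports Defs "Jordan_Normal_Form.Spectral_Radius"
begin

text \<open>Garland's method, with eigenvalues counted instead of bounded. Give a simplex \<open>\<sigma>\<close> of dimension
  \<open>D - 1\<close> the weight \<open>w \<sigma>\<close>, its number of cofaces \<open>d \<sigma>\<close>, or \<open>1\<close> if it has none. If a cycle \<open>c\<close> is
  orthogonal to all boundaries for the inner product with weights \<open>1 / w\<close>, then \<open>h = c / w\<close> is a
  cocycle. For a \<open>(D - 2)\<close>-simplex \<open>\<tau>\<close>, let \<open>h\<^sub>\<tau>\<close> be the function \<open>v \<mapsto> h (v \<tau>)\<close> on the vertices of
  the link. It is orthogonal to the constants because \<open>c\<close> is a cycle, and since \<open>h\<close> is a cocycle the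
  Dirichlet energies satisfy \<open>\<Sum>\<^sub>\<tau> E\<^sub>\<tau> (h\<^sub>\<tau>) = (1 - 1/D) \<Sum>\<^sub>\<tau> \<Sum>\<^sub>v d (v \<tau>) (h\<^sub>\<tau> v)\<^sup>2\<close>, which is at most
  \<open>(1 - 1/D) \<Sum>\<^sub>\<tau> \<parallel>h\<^sub>\<tau>\<parallel>\<^sup>2\<close>. If every \<open>h\<^sub>\<tau>\<close> is moreover orthogonal to all eigenvectors of the link
  Laplacian with eigenvalue at most \<open>1 - 1/D\<close>, which beyond the constants takes
  \<open>\<gamma> (lk \<tau>; 1 - 1/D)\<close> linear conditions, then this forces \<open>h = 0\<close>.\<close>

section \<open>Diagonalization of real symmetric matrices\<close>

text \<open>Over the complex numbers there is an eigenvector \<open>z\<close> with eigenvalue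
  \<open>e\<close>. Symmetry makes the Hermitian form of \<open>A\<close> at \<open>z\<close>
  self-conjugate, so \<open>e\<close> is real; as a root of the real characteristic polynomial it
  also has a real eigenvector, which is then normalized.\<close>

lemma real_symmetric_eigenvector:
  fixes A :: "real mat"
  assumes A: "A \<in> carrier_mat n n" and sym: "transpose_mat A = A" and "n > 0"
  obtains r v where "v \<in> carrier_vec n" "v \<bullet> v = 1" "A *\<^sub>v v = r \<cdot>\<^sub>v v"
proof -
  let ?C = "map_mat of_real A :: complex mat"
  have C: "?C \<in> carrier_mat n n" using A by simp
  obtain e where e: "eigenvalue ?C e"
    using spectrum_non_empty[OF C \<open>n > 0\<close>] by (auto simp: spectrum_def)
  then obtain z where z: "z \<in> carrier_vec n" "z \<noteq> 0\<^sub>v n" and eig: "?C *\<^sub>v z = e \<cdot>\<^sub>v z"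
    using A by (auto simp: eigenvalue_def eigenvector_def)
  have entry: "(\<Sum>j<n. of_real (A $$ (i, j)) * z $ j) = e * z $ i" if "i < n" for i
    using arg_cong[OF eig, of "\<lambda>w. w $ i"] that A z
    by (simp add: scalar_prod_def lessThan_atLeast0)
  have symA: "A $$ (i, j) = A $$ (j, i)" if "i < n" "j < n" for i j
    using arg_cong[OF sym, of "\<lambda>M. M $$ (i, j)"] that A by simp
  define S where "S = (\<Sum>i<n. \<Sum>j<n. cnj (z $ i) * of_real (A $$ (i, j)) * z $ j)"
  define N where "N = (\<Sum>i<n. (cmod (z $ i))\<^sup>2)"
  have "S = (\<Sum>i<n. cnj (z $ i) * (\<Sum>j<n. of_real (A $$ (i, j)) * z $ j))"
    by (simp add: S_def sum_distrib_left mult.assoc)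
  also have "\<dots> = (\<Sum>i<n. e * of_real ((cmod (z $ i))\<^sup>2))"
  proof (intro sum.cong refl)
    fix i assume "i \<in> {..<n}"
    then have "(\<Sum>j<n. of_real (A $$ (i, j)) * z $ j) = e * z $ i"
      by (simp add: entry)
    then show "cnj (z $ i) * (\<Sum>j<n. of_real (A $$ (i, j)) * z $ j) = e * of_real ((cmod (z $ i))\<^sup>2)"
      by (metis complex_norm_square mult.commute mult.left_commute)
  qed
  also have "\<dots> = e * of_real N"
    by (simp add: N_def sum_distrib_left)
  finally have SN: "S = e * of_real N" .
  have "cnj S = (\<Sum>i<n. \<Sum>j<n. cnj (z $ j) * of_real (A $$ (i, j)) * z $ i)"
    by (simp add: S_def mult_ac)
  also have "\<dots> = (\<Sum>j<n. \<Sum>i<n. cnj (z $ j) * of_real (A $$ (i, j)) * z $ i)"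
    by (rule sum.swap)
  also have "\<dots> = S"
    unfolding S_def by (intro sum.cong) (auto simp: symA)
  finally have "cnj S = S" .
  moreover have "N \<noteq> 0"
  proof
    assume "N = 0"
    then have "\<forall>i<n. z $ i = 0"
      by (subst (asm) N_def, subst (asm) sum_nonneg_eq_0_iff) auto
    then have "z = 0\<^sub>v n" using z by (intro eq_vecI) auto
    with z show False by simp
  qed
  ultimately have "cnj e = e"
    by (simp add: SN)
  then obtain r where r: "e = of_real r"
    by (metis Reals_cases Reals_cnj_iff)
  have "poly (map_poly of_real (char_poly A)) (of_real r :: complex) = 0"
    using e unfolding eigenvalue_root_char_poly[OF C] r of_real_hom.char_poly_hom[OF A] .
  then have "poly (char_poly A) r = 0"
    by simp
  then have "eigenvalue A r"
    by (simp add: eigenvalue_root_char_poly[OF A])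
  then obtain w where w: "w \<in> carrier_vec n" "w \<noteq> 0\<^sub>v n" "A *\<^sub>v w = r \<cdot>\<^sub>v w"
    using A by (auto simp: eigenvalue_def eigenvector_def)
  have pos: "w \<bullet> w > 0"
  proof -
    have "w \<bullet> w = (\<Sum>i<n. (w $ i)\<^sup>2)"
      using w by (simp add: scalar_prod_def power2_eq_square lessThan_atLeast0)
    moreover have "\<dots> \<noteq> 0"
    proof
      assume "(\<Sum>i<n. (w $ i)\<^sup>2) = 0"
      then have "\<forall>i<n. w $ i = 0"
        by (subst (asm) sum_nonneg_eq_0_iff) auto
      then have "w = 0\<^sub>v n" using w by (intro eq_vecI) auto
      with w show False by simp
    qed
    ultimately show ?thesis
      by (metis less_eq_real_def sum_nonneg zero_le_power2)
  qed
  define v where "v = (1 / sqrt (w \<bullet> w)) \<cdot>\<^sub>v w"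
  have "v \<in> carrier_vec n" "v \<bullet> v = 1"
    using w pos by (auto simp: v_def)
  moreover have "A *\<^sub>v v = r \<cdot>\<^sub>v v"
    using w A by (simp add: v_def mult_mat_vec smult_smult_assoc mult.commute)
  ultimately show ?thesis by (rule that)
qed

text \<open>The Householder reflection exchanging \<open>v\<close> and the first unit vector.\<close>

lemma orthogonal_first_column:
  fixes v :: "real vec"
  assumes v: "v \<in> carrier_vec n" "v \<bullet> v = 1" and "n > 0"
  obtains H where "H \<in> carrier_mat n n" "transpose_mat H = H" "H * H = 1\<^sub>m n"
    "H *\<^sub>v unit_vec n 0 = v"
proof (cases "v = unit_vec n 0")
  case True
  then show ?thesis
    by (intro that[of "1\<^sub>m n"]) auto
next
  case False
  \<comment> \<open>With \<open>u\<close> = v - e_0 the matrix \<open>?H\<close> is I - c u u^T, the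
    reflection in the hyperplane orthogonal to \<open>u\<close>. The case v = e_0 is split off
    because \<open>u\<close> is zero there.\<close>
  define u where "u i = v $ i - (if i = 0 then 1 else 0)" for i
  define c where "c = 2 / (\<Sum>k<n. u k * u k)"
  let ?H = "mat n n (\<lambda>(i, j). (if i = j then 1 else 0) - c * u i * u j)"
  have vv: "(\<Sum>k<n. v $ k * v $ k) = 1"
    using v by (simp add: scalar_prod_def lessThan_atLeast0)
  have "(\<Sum>k<n. u k * u k) =
      (\<Sum>k<n. v $ k * v $ k - (if k = 0 then 2 * v $ k - 1 else 0))"
    by (intro sum.cong) (auto simp: u_def algebra_simps)
  also have "\<dots> = 2 - 2 * v $ 0"
    using \<open>n > 0\<close> vv by (simp add: sum_subtractf)
  finally have uu: "(\<Sum>k<n. u k * u k) = 2 - 2 * v $ 0" .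
  have nz: "(\<Sum>k<n. u k * u k) \<noteq> 0"
  proof
    assume "(\<Sum>k<n. u k * u k) = 0"
    then have "\<forall>k<n. u k = 0"
      by (subst (asm) sum_nonneg_eq_0_iff) auto
    then have "v = unit_vec n 0"
      using v by (intro eq_vecI) (auto simp: u_def)
    with False show False by simp
  qed
  have cc: "c * (\<Sum>k<n. u k * u k) = 2"
    using nz by (simp add: c_def)
  show ?thesis
  proof (rule that[of ?H])
    show "transpose_mat ?H = ?H"
      by (rule eq_matI) auto
    show "?H * ?H = 1\<^sub>m n"
    proof (rule eq_matI)
      fix i j assume "i < dim_row (1\<^sub>m n :: real mat)" "j < dim_col (1\<^sub>m n :: real mat)"
      then have ij: "i < n" "j < n" by auto
      have "(\<Sum>k<n. ((if i = k then 1 else 0) - c * u i * u k) *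
            ((if k = j then 1 else 0) - c * u k * u j)) =
          (\<Sum>k<n. (if k = i then (if i = j then 1 else 0) - c * u i * u j else 0)
            - (if k = j then c * u i * u j else 0) + c * u i * u j * (c * (u k * u k)))"
        by (intro sum.cong) (auto simp: algebra_simps)
      also have "\<dots> = (if i = j then 1 else 0) - 2 * (c * u i * u j)
          + c * u i * u j * (c * (\<Sum>k<n. u k * u k))"
        using ij by (simp add: sum.distrib sum_subtractf sum_distrib_left)
      also have "\<dots> = (if i = j then 1 else 0)"
        by (simp add: cc)
      finally show "(?H * ?H) $$ (i, j) = 1\<^sub>m n $$ (i, j)"
        using ij by (simp add: scalar_prod_def lessThan_atLeast0)
    qed auto
    show "?H *\<^sub>v unit_vec n 0 = v"
    proof (rule eq_vecI)
      fix i assume "i < dim_vec v"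
      then have i: "i < n" using v by simp
      \<comment> \<open>As \<open>v\<close> is a unit vector, |u|^2 = 2 (1 - v_0). Hence c u_0 = -1,
        and \<open>?H\<close> sends e_0 to e_0 + u = v.\<close>
      have "c * (1 - v $ 0) = 1"
        using cc uu by (simp add: algebra_simps)
      moreover have "c * u i * u 0 = - (c * (1 - v $ 0)) * u i"
        by (simp add: u_def[of 0] algebra_simps)
      ultimately have "c * u i * u 0 = - u i"
        by simp
      then show "(?H *\<^sub>v unit_vec n 0) $ i = v $ i"
        using i \<open>n > 0\<close> by (simp add: u_def)
    qed (use v in auto)
  qed auto
qed

text \<open>Induction on the dimension: conjugation by a reflection that moves a unit eigenvector to
  the first coordinate axis clears the first column below the diagonal, and symmetry clears the
  first row. The remaining block is again symmetric.\<close>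

lemma real_symmetric_diagonalizable:
  fixes A :: "real mat"
  assumes "A \<in> carrier_mat n n" "transpose_mat A = A"
  shows "\<exists>U d. U \<in> carrier_mat n n \<and> transpose_mat U * U = 1\<^sub>m n \<and> A = U * mat_diag n d * transpose_mat U"
  using assms
proof (induction n arbitrary: A)
  case 0
  then show ?case
    by (intro exI[of _ "1\<^sub>m 0"] exI[of _ "\<lambda>_. 0"]) (auto intro!: eq_matI)
next
  case (Suc m)
  let ?n = "Suc m"
  note A = Suc.prems(1) and sym = Suc.prems(2)
  obtain r v where v: "v \<in> carrier_vec ?n" "v \<bullet> v = 1" and Av: "A *\<^sub>v v = r \<cdot>\<^sub>v v"
    using real_symmetric_eigenvector[OF A sym] by blast
  obtain H where H: "H \<in> carrier_mat ?n ?n" and HT: "transpose_mat H = H" and HH: "H * H = 1\<^sub>m ?n"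
    and He: "H *\<^sub>v unit_vec ?n 0 = v"
    using orthogonal_first_column[OF v] by blast
  define C where "C = H * A * H"
  have C: "C \<in> carrier_mat ?n ?n" using A H by (simp add: C_def)
  have "transpose_mat C = C"
    using A H by (simp add: C_def transpose_mult[of _ ?n ?n _ ?n] HT sym assoc_mult_mat[of _ ?n ?n _ ?n _ ?n])
  then have symC: "C $$ (i, j) = C $$ (j, i)" if "i < ?n" "j < ?n" for i j
    using that C by (metis carrier_matD index_transpose_mat(1))
  have "H *\<^sub>v v = unit_vec ?n 0"
    using H HH by (metis He assoc_mult_mat_vec one_mult_mat_vec unit_vec_carrier)
  then have "C *\<^sub>v unit_vec ?n 0 = r \<cdot>\<^sub>v unit_vec ?n 0"
    using A H v by (simp add: C_def assoc_mult_mat_vec[of _ ?n ?n _ ?n] He Av mult_mat_vec[of _ ?n ?n])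
  then have C0: "C $$ (i, 0) = (if i = 0 then r else 0)" if "i < ?n" for i
  proof -
    have "C $$ (i, 0) = (C *\<^sub>v unit_vec ?n 0) $ i"
      using that C by simp
    then show ?thesis using that \<open>C *\<^sub>v unit_vec ?n 0 = _\<close> by simp
  qed
  define B where "B = mat m m (\<lambda>(i, j). C $$ (Suc i, Suc j))"
  have B: "B \<in> carrier_mat m m" "transpose_mat B = B"
    by (auto simp: B_def symC intro!: eq_matI)
  obtain U d where U: "U \<in> carrier_mat m m" "transpose_mat U * U = 1\<^sub>m m"
    and BU: "B = U * mat_diag m d * transpose_mat U"
    using Suc.IH[OF B] by blast
  let ?blk = "\<lambda>x M. four_block_mat x (0\<^sub>m 1 m) (0\<^sub>m m 1) M :: real mat"
  have CB: "C = ?blk (mat 1 1 (\<lambda>_. r)) B"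
    using C C0 symC by (intro eq_matI) (auto simp: B_def)
  define K where "K = ?blk (1\<^sub>m 1) U"
  have K: "K \<in> carrier_mat ?n ?n"
    using four_block_carrier_mat[of "1\<^sub>m 1" 1 1 U m m] U by (simp add: K_def)
  have KT: "transpose_mat K = ?blk (1\<^sub>m 1) (transpose_mat U)"
    unfolding K_def using U by (subst transpose_four_block_mat[of _ 1 1 _ m _ m]) auto
  have "transpose_mat K * K = 1\<^sub>m ?n"
    unfolding KT unfolding K_def using U
    by (subst mult_four_block_mat[of _ 1 1 _ m _ m _ _ 1 _ m]) auto
  define d' where "d' i = (case i of 0 \<Rightarrow> r | Suc j \<Rightarrow> d j)" for i
  have D: "mat_diag ?n d' = ?blk (mat 1 1 (\<lambda>_. r)) (mat_diag m d)"
    by (intro eq_matI) (auto simp: mat_diag_def d'_def split: nat.splits)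
  have UD: "U * mat_diag m d \<in> carrier_mat m m"
    using U by simp
  have "K * mat_diag ?n d' = ?blk (mat 1 1 (\<lambda>_. r)) (U * mat_diag m d)"
    unfolding K_def D using U left_mult_zero_mat[OF mat_diag_dim[of m d], of 1]
    by (subst mult_four_block_mat[of _ 1 1 _ m _ m _ _ 1 _ m]) auto
  then have "K * mat_diag ?n d' * transpose_mat K = ?blk (mat 1 1 (\<lambda>_. r)) B"
    unfolding KT BU using U UD
      right_mult_zero_mat[OF UD, of 1] left_add_zero_mat[OF mult_carrier_mat[OF UD, of "transpose_mat U" m]]
    by simp (subst mult_four_block_mat[of _ 1 1 _ m _ m _ _ 1 _ m]; auto)
  then have CK: "C = K * mat_diag ?n d' * transpose_mat K" by (simp add: CB)
  \<comment> \<open>\<open>H\<close> is its own inverse, so \<open>A\<close> is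
    \<open>H * C * H\<close> and the diagonalization of \<open>C\<close> by \<open>K\<close> becomes
    one of \<open>A\<close> by \<open>H * K\<close>.\<close>
  define W where "W = H * K"
  have W: "W \<in> carrier_mat ?n ?n" using H K by (simp add: W_def)
  have WT: "transpose_mat W = transpose_mat K * H"
    using H K by (simp add: W_def transpose_mult[of _ ?n ?n _ ?n] HT)
  have assoc: "X * Y * Z = X * (Y * Z)" if "X \<in> carrier_mat ?n ?n" "Y \<in> carrier_mat ?n ?n"
    "Z \<in> carrier_mat ?n ?n" for X Y Z :: "real mat"
    using that by simp
  have HHX: "H * (H * X) = X" if "X \<in> carrier_mat ?n ?n" for X
    using that H HH by (metis assoc_mult_mat left_mult_one_mat)
  have "transpose_mat W * W = 1\<^sub>m ?n"
    unfolding WT unfolding W_def using H K \<open>transpose_mat K * K = 1\<^sub>m ?n\<close>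
    by (simp add: assoc HHX)
  moreover have "W * X * transpose_mat W = H * (K * X * transpose_mat K) * H"
    if "X \<in> carrier_mat ?n ?n" for X
    unfolding WT unfolding W_def using H K that by (simp add: assoc)
  moreover have "H * (K * mat_diag ?n d' * transpose_mat K) * H = A"
    unfolding CK[symmetric] C_def using A H HH by (simp add: assoc HHX)
  ultimately show ?case using W by (metis mat_diag_dim)
qed

text \<open>\<open>u i\<close> is column \<open>i\<close> of the orthogonal matrix \<open>U\<close>,
  a unit eigenvector for \<open>d i\<close>. Orthonormal columns imply orthonormal rows since a left
  inverse of a square matrix is a right inverse, and similarity to the diagonal matrix gives the
  eigenvalues with multiplicity.\<close>

lemma real_symmetric_spectral_sums:
  fixes S :: "real mat"
  assumes S: "S \<in> carrier_mat n n" "transpose_mat S = S"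
  shows "\<exists>d u. (\<forall>k<n. \<forall>l<n. S $$ (k, l) = (\<Sum>i<n. d i * u i k * u i l)) \<and>
    (\<forall>i<n. \<forall>j<n. (\<Sum>k<n. u i k * u j k) = (if i = j then 1 else 0)) \<and>
    (\<forall>k<n. \<forall>l<n. (\<Sum>i<n. u i k * u i l) = (if k = l then 1 else 0)) \<and>
    proots (char_poly S) = mset (map d [0..<n])"
proof -
  obtain U d where U: "U \<in> carrier_mat n n" and UU: "transpose_mat U * U = 1\<^sub>m n"
    and SU: "S = U * mat_diag n d * transpose_mat U"
    using real_symmetric_diagonalizable[OF S] by blast
  have UT: "transpose_mat U \<in> carrier_mat n n" using U by simp
  have UU': "U * transpose_mat U = 1\<^sub>m n"
    by (rule mat_mult_left_right_inverse[OF UT U UU])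
  show ?thesis
  proof (rule exI[of _ d], rule exI[of _ "\<lambda>i k. U $$ (k, i)"], intro conjI allI impI)
    fix k l assume "k < n" "l < n"
    then show "S $$ (k, l) = (\<Sum>i<n. d i * U $$ (k, i) * U $$ (l, i))"
      using U unfolding SU mat_diag_mult_right[OF U]
      by (simp add: scalar_prod_def lessThan_atLeast0 mult_ac)
  next
    fix i j assume "i < n" "j < n"
    then show "(\<Sum>k<n. U $$ (k, i) * U $$ (k, j)) = (if i = j then 1 else 0)"
      using U arg_cong[OF UU, of "\<lambda>M. M $$ (i, j)"]
      by (simp add: scalar_prod_def lessThan_atLeast0)
  next
    fix k l assume "k < n" "l < n"
    then show "(\<Sum>i<n. U $$ (k, i) * U $$ (l, i)) = (if k = l then 1 else 0)"
      using U arg_cong[OF UU', of "\<lambda>M. M $$ (k, l)"]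
      by (simp add: scalar_prod_def lessThan_atLeast0)
  next
    have "similar_mat S (mat_diag n d)"
      using S U UU UU' SU by (intro similar_matI[of _ _ U "transpose_mat U" n]) auto
    then have "char_poly S = char_poly (mat_diag n d)"
      by (rule char_poly_similar)
    also have "\<dots> = (\<Prod>a\<leftarrow>diag_mat (mat_diag n d). [:- a, 1:])"
      by (rule char_poly_upper_triangular[of _ n]) (auto simp: mat_diag_def upper_triangular_def)
    also have "diag_mat (mat_diag n d) = map d [0..<n]"
      by (auto simp: diag_mat_def mat_diag_def)
    finally have "char_poly S = (\<Prod>p\<leftarrow>map (\<lambda>i. [:- d i, 1:]) [0..<n]. p)"
      by (simp add: comp_def)
    also have "proots \<dots> = (\<Sum>p\<leftarrow>map (\<lambda>i. [:- d i, 1:]) [0..<n]. proots p)"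
      by (rule proots_prod_list) auto
    also have "\<dots> = mset (map d [0..<n])"
      by (induction n) (simp_all add: comp_def)
    finally show "proots (char_poly S) = mset (map d [0..<n])" .
  qed
qed

text \<open>A kernel vector \<open>z\<close> has components only along eigenvectors of eigenvalue 0,
  which is at most \<alpha>. Orthogonality to \<open>z\<close> can therefore replace orthogonality
  to one of the eigenvectors with eigenvalue at most \<alpha>, chosen not orthogonal to
  \<open>z\<close>. This saves the condition behind \<open>Suc (card K)\<close>, and
  \<open>g\<close> is left in the span of the eigenvectors above \<alpha>.\<close>

lemma symmetric_form_gap:
  fixes S :: "real mat" and z :: "nat \<Rightarrow> real"
  assumes S: "S \<in> carrier_mat n n" "transpose_mat S = S" and "\<alpha> \<ge> 0"
    and ker: "\<And>k. k < n \<Longrightarrow> (\<Sum>l<n. S $$ (k, l) * z l) = 0" and "\<exists>l<n. z l \<noteq> 0"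
  obtains K :: "nat set" and \<psi> :: "nat \<Rightarrow> nat \<Rightarrow> real" where
    "finite K" "Suc (card K) = size {#l \<in># proots (char_poly S). l \<le> \<alpha>#}"
    "\<And>g. (\<Sum>k<n. z k * g k) = 0 \<Longrightarrow> (\<And>i. i \<in> K \<Longrightarrow> (\<Sum>k<n. \<psi> i k * g k) = 0) \<Longrightarrow>
      \<exists>k<n. g k \<noteq> 0 \<Longrightarrow> \<alpha> * (\<Sum>k<n. (g k)\<^sup>2) < (\<Sum>k<n. \<Sum>l<n. g k * S $$ (k, l) * g l)"
proof -
  obtain d u where Su: "\<forall>k<n. \<forall>l<n. S $$ (k, l) = (\<Sum>i<n. d i * u i k * u i l)"
    and row: "\<forall>i<n. \<forall>j<n. (\<Sum>k<n. u i k * u j k) = (if i = j then 1 else 0)"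
    and col: "\<forall>k<n. \<forall>l<n. (\<Sum>i<n. u i k * u i l) = (if k = l then 1 else 0)"
    and eigs: "proots (char_poly S) = mset (map d [0..<n])"
    using real_symmetric_spectral_sums[OF S] by blast
  \<comment> \<open>\<open>T g i\<close> is the coordinate of \<open>g\<close> along the eigenvector
    \<open>u i\<close>.\<close>
  define T where "T g i = (\<Sum>k<n. u i k * g k)" for g i
  have bilinear: "(\<Sum>i<n. c i * T f i * T g i) = (\<Sum>k<n. \<Sum>l<n. f k * (\<Sum>i<n. c i * u i k * u i l) * g l)"
    for c f g
  proof -
    have "(\<Sum>i<n. c i * T f i * T g i) = (\<Sum>i<n. \<Sum>k<n. \<Sum>l<n. f k * (c i * u i k * u i l) * g l)"
      by (simp add: T_def sum_product sum_distrib_left mult_ac)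
    also have "\<dots> = (\<Sum>k<n. \<Sum>i<n. \<Sum>l<n. f k * (c i * u i k * u i l) * g l)"
      by (rule sum.swap)
    also have "\<dots> = (\<Sum>k<n. \<Sum>l<n. \<Sum>i<n. f k * (c i * u i k * u i l) * g l)"
      by (intro sum.cong sum.swap refl)
    finally show ?thesis
      by (simp add: sum_distrib_left sum_distrib_right)
  qed
  have parseval: "(\<Sum>i<n. T f i * T g i) = (\<Sum>k<n. f k * g k)" for f g
    using bilinear[of "\<lambda>_. 1" f g] col by (simp add: if_distrib if_distribR cong: if_cong)
  have form: "(\<Sum>i<n. d i * T f i * T g i) = (\<Sum>k<n. \<Sum>l<n. f k * S $$ (k, l) * g l)" for f g
    by (simp add: bilinear Su)
  \<comment> \<open>The form evaluated at \<open>u i\<close> and \<open>z\<close> is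
    \<open>d i * T z i\<close>, and it vanishes because \<open>z\<close> is in the kernel.\<close>
  have dz: "d i * T z i = 0" if "i < n" for i
  proof -
    have "(\<Sum>j<n. d j * T (u i) j * T z j) = d i * T z i"
      using that by (simp add: T_def[of "u i"] row if_distrib if_distribR cong: if_cong)
    moreover have "(\<Sum>j<n. d j * T (u i) j * T z j) = 0"
      unfolding form using ker by (simp add: mult.assoc flip: sum_distrib_left)
    ultimately show ?thesis by simp
  qed
  obtain k where k: "k < n" "T z k \<noteq> 0"
  proof -
    obtain l where "l < n" "z l \<noteq> 0" using assms by blast
    then have "(\<Sum>k<n. z k * z k) \<noteq> 0"
      by (subst sum_nonneg_eq_0_iff) auto
    then have "(\<Sum>i<n. T z i * T z i) \<noteq> 0"
      unfolding parseval .
    then obtain k where "k \<in> {..<n}" "T z k * T z k \<noteq> 0"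
      by (rule sum.not_neutral_contains_not_neutral)
    then show ?thesis
      by (intro that[of k]) auto
  qed
  define I where "I = {i. i < n \<and> d i \<le> \<alpha>}"
  have "k \<in> I" using k dz[of k] \<open>\<alpha> \<ge> 0\<close> by (simp add: I_def)
  moreover have "finite I" by (simp add: I_def)
  moreover have "card I = size {#l \<in># proots (char_poly S). l \<le> \<alpha>#}"
  proof -
    have "size {#l \<in># proots (char_poly S). l \<le> \<alpha>#} = length (filter (\<lambda>i. d i \<le> \<alpha>) [0..<n])"
      by (simp only: eigs mset_filter[symmetric] size_mset filter_map length_map comp_def)
    also have "\<dots> = card I"
      by (subst distinct_card[symmetric]) (auto simp: I_def intro!: arg_cong[of _ _ card])
    finally show ?thesis by simp
  qed
  ultimately have "Suc (card (I - {k})) = size {#l \<in># proots (char_poly S). l \<le> \<alpha>#}"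
    by (metis card_Suc_Diff1)
  moreover have "\<alpha> * (\<Sum>k<n. (g k)\<^sup>2) < (\<Sum>k<n. \<Sum>l<n. g k * S $$ (k, l) * g l)"
    if z0: "(\<Sum>k<n. z k * g k) = 0" and K0: "\<And>i. i \<in> I - {k} \<Longrightarrow> (\<Sum>k<n. u i k * g k) = 0"
      and g: "\<exists>k<n. g k \<noteq> 0" for g
  proof -
    \<comment> \<open>For \<open>i\<close> other than \<open>k\<close>, either \<open>i\<close> is
      in \<open>I\<close> and \<open>T g i\<close> vanishes by assumption, or \<open>d i\<close>
      exceeds \<alpha> and is therefore nonzero, so that \<open>T z i\<close> vanishes.\<close>
    have "(\<Sum>i<n. T z i * T g i) = (\<Sum>i<n. if i = k then T z k * T g k else 0)"
    proof (intro sum.cong refl)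
      fix i assume "i \<in> {..<n}"
      then show "T z i * T g i = (if i = k then T z k * T g k else 0)"
        using dz[of i] K0[of i] \<open>\<alpha> \<ge> 0\<close> by (auto simp: I_def T_def[of g])
    qed
    then have "T z k * T g k = 0"
      using k z0 by (simp add: parseval)
    then have T0: "T g i = 0" if "i \<in> I" for i
      using that K0[of i] k by (cases "i = k") (auto simp: T_def[of g])
    obtain l where "l < n" "g l \<noteq> 0" using g by blast
    then have "(\<Sum>k<n. g k * g k) \<noteq> 0"
      by (subst sum_nonneg_eq_0_iff) auto
    then have "(\<Sum>i<n. T g i * T g i) \<noteq> 0"
      unfolding parseval .
    then obtain i where "i \<in> {..<n}" "T g i * T g i \<noteq> 0"
      by (rule sum.not_neutral_contains_not_neutral)
    then have i: "i < n" "T g i \<noteq> 0" by auto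
    have "\<alpha> * (\<Sum>k<n. (g k)\<^sup>2) = (\<Sum>i<n. \<alpha> * (T g i * T g i))"
      unfolding sum_distrib_left[symmetric] parseval power2_eq_square ..
    also have "\<dots> < (\<Sum>i<n. d i * (T g i * T g i))"
    proof (rule sum_strict_mono_ex1)
      show "\<forall>i\<in>{..<n}. \<alpha> * (T g i * T g i) \<le> d i * (T g i * T g i)"
      proof
        fix i assume "i \<in> {..<n}"
        then show "\<alpha> * (T g i * T g i) \<le> d i * (T g i * T g i)"
          using T0[of i] by (cases "i \<in> I") (auto simp: I_def intro!: mult_right_mono)
      qed
      have "T g i * T g i > 0"
        using i by (metis not_real_square_gt_zero)
      moreover have "\<alpha> < d i"
        using i T0[of i] by (force simp: I_def)
      ultimately show "\<exists>i\<in>{..<n}. \<alpha> * (T g i * T g i) < d i * (T g i * T g i)"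
        using i by (intro bexI[of _ i] mult_strict_right_mono) auto
    qed simp
    also have "\<dots> = (\<Sum>k<n. \<Sum>l<n. g k * S $$ (k, l) * g l)"
      using form[of g g] by (simp only: mult.assoc)
    finally show ?thesis .
  qed
  ultimately show ?thesis
    using that[of "I - {k}" u] \<open>finite I\<close> by blast
qed

section \<open>Few linear conditions force a large Dirichlet energy\<close>

text \<open>The Laplacian need not be symmetric, but it is self-adjoint for the inner product with
  weights \<open>m\<close>. Conjugation by the square root of \<open>m\<close> gives a symmetric
  matrix \<open>S\<close> with the same eigenvalues, whose form is the Dirichlet energy and whose
  kernel contains the image \<open>s\<close> of the constants. An isolated vertex has weight 1 and a
  zero row in the Laplacian, so it adds to the norm but not to the energy.\<close>

lemma laplacian_functionals:
  fixes W :: "'a set" and E :: "'a set set" and \<alpha> :: real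
  assumes W: "finite W" and noloop: "\<And>v. v \<in> W \<Longrightarrow> {v} \<notin> E" and "\<alpha> \<ge> 0"
  defines "G \<equiv> (W, E)"
  defines "m \<equiv> \<lambda>v. real (max 1 (graph_degree G v))"
  shows "\<exists>(K :: nat set) \<phi>. finite K \<and> int (card K) = gamma G \<alpha> \<and>
    (\<forall>f. (\<Sum>v\<in>W. m v * f v) = 0 \<longrightarrow> (\<forall>i\<in>K. (\<Sum>v\<in>W. \<phi> i v * f v) = 0) \<longrightarrow>
      (\<exists>v\<in>W. f v \<noteq> 0) \<longrightarrow> \<alpha> * (\<Sum>v\<in>W. m v * (f v)\<^sup>2) <
        (\<Sum>v\<in>W. real (graph_degree G v) * (f v)\<^sup>2) - (\<Sum>v\<in>W. \<Sum>w | w \<in> W \<and> {v, w} \<in> E. f v * f w))"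
proof (cases "W = {}")
  case True
  \<comment> \<open>On the empty graph \<open>gamma\<close> is 0 by convention and no function has a
    nonzero value, so the empty family of conditions works.\<close>
  then show ?thesis
    by (intro exI[of _ "{}"]) (auto simp: G_def gamma_def)
next
  case False
  define n where "n = card W"
  define vs where "vs = vertex_list G"
  obtain xs where "distinct xs \<and> set xs = fst G"
    using finite_distinct_list[OF W] by (auto simp: G_def)
  then have "distinct vs \<and> set vs = fst G"
    unfolding vs_def vertex_list_def by (rule someI)
  then have vs: "distinct vs" "set vs = W" by (auto simp: G_def)
  then have len: "length vs = n"
    by (simp add: n_def distinct_card[symmetric])
  have bij: "bij_betw (\<lambda>i. vs ! i) {..<n} W"
    using bij_betw_nth[OF vs(1), of "{..<n}" W] vs len by auto
  have reindex: "(\<Sum>v\<in>W. F v) = (\<Sum>i<n. F (vs ! i))" for F :: "'a \<Rightarrow> real"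
    by (rule sum.reindex_bij_betw[OF bij, symmetric])
  have memW: "vs ! i \<in> W" if "i < n" for i
    using that vs len by auto
  have vs_inj: "vs ! i = vs ! j \<longleftrightarrow> i = j" if "i < n" "j < n" for i j
    using that vs len by (simp add: nth_eq_iff_index_eq)
  have m_pos: "m v > 0" for v by (simp add: m_def)
  let ?a = "averaging_entry G"
  define L where "L = laplacian G"
  have L: "L \<in> carrier_mat n n"
    by (auto simp: L_def laplacian_def averaging_matrix_def Let_def G_def n_def)
  have L_entry: "L $$ (i, j) = (if i = j then 1 else 0) - ?a (vs ! i) (vs ! j)" if "i < n" "j < n" for i j
    using that by (simp add: L_def laplacian_def averaging_matrix_def Let_def G_def n_def vs_def)
  have nbrs: "graph_degree G v = card {w \<in> W. {v, w} \<in> E}" for v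
    by (simp add: graph_degree_def G_def)
  \<comment> \<open>The product is symmetric in \<open>v\<close> and \<open>w\<close>; the symmetry
    of \<open>S\<close> rests on this.\<close>
  have ma: "m v * ?a v w = (if {v, w} \<in> E then 1 else if v = w \<and> graph_degree G v = 0 then 1 else 0)"
    if "v \<in> W" "w \<in> W" for v w
  proof (cases "{v, w} \<in> E")
    case True
    then have "w \<in> {w \<in> W. {v, w} \<in> E}" using that by simp
    then have "graph_degree G v > 0"
      unfolding nbrs card_gt_0_iff using W by auto
    then show ?thesis
      using True by (simp add: averaging_entry_def m_def G_def)
  qed (auto simp: averaging_entry_def m_def G_def)
  have mf: "(\<Sum>w\<in>W. m v * ?a v w * g w) =
      (\<Sum>w | w \<in> W \<and> {v, w} \<in> E. g w) + (if graph_degree G v = 0 then g v else 0)"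
    if "v \<in> W" for v g
  proof -
    have "(\<Sum>w\<in>W. m v * ?a v w * g w) =
        (\<Sum>w\<in>W. (if {v, w} \<in> E then g w else 0) + (if w = v then if graph_degree G v = 0 then g v else 0 else 0))"
      using noloop that by (intro sum.cong) (auto simp: ma)
    also have "\<dots> = (\<Sum>w\<in>W. if {v, w} \<in> E then g w else 0) + (if graph_degree G v = 0 then g v else 0)"
      using W that by (simp add: sum.distrib)
    also have "(\<Sum>w\<in>W. if {v, w} \<in> E then g w else 0) = (\<Sum>w | w \<in> W \<and> {v, w} \<in> E. g w)"
      using W by (simp add: sum.inter_filter)
    finally show ?thesis .
  qed
  have degm: "m v = real (graph_degree G v) + (if graph_degree G v = 0 then 1 else 0)" for v
    by (auto simp: m_def)
  define s where "s i = sqrt (m (vs ! i))" for i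
  have s: "s i > 0" "s i * s i = m (vs ! i)" for i
    using m_pos[of "vs ! i"] by (auto simp: s_def)
  define S where "S = mat n n (\<lambda>(i, j). s i * L $$ (i, j) / s j)"
  have S: "S \<in> carrier_mat n n" by (simp add: S_def)
  have sSs: "s i * S $$ (i, j) * s j = m (vs ! i) * L $$ (i, j)" if "i < n" "j < n" for i j
    using that s(1)[of j] s(2)[of i, symmetric] by (simp add: S_def)
  have symS: "transpose_mat S = S"
  proof (rule eq_matI)
    fix i j assume "i < dim_row S" "j < dim_col S"
    then have ij: "i < n" "j < n" using S by auto
    have "s i * S $$ (i, j) * s j = s j * S $$ (j, i) * s i"
      using ij ma[OF memW memW, of i j] ma[OF memW memW, of j i]
      by (auto simp: sSs L_entry right_diff_distrib vs_inj insert_commute)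
    then have "S $$ (i, j) = S $$ (j, i)"
      using s(1)[of i] s(1)[of j] by simp
    then show "transpose_mat S $$ (i, j) = S $$ (i, j)"
      using ij S by simp
  qed (use S in auto)
  have "similar_mat L S"
  proof (rule similar_matI)
    show "{L, S, mat_diag n (\<lambda>i. 1 / s i), mat_diag n s} \<subseteq> carrier_mat n n"
      using L S by simp
    show "L = mat_diag n (\<lambda>i. 1 / s i) * S * mat_diag n s"
      unfolding mat_diag_mult_left[OF S]
      by (subst mat_diag_mult_right[of _ n]) (use s(1) L in \<open>auto intro!: eq_matI simp: S_def less_imp_neq[symmetric]\<close>)
  qed (use s(1) in \<open>auto simp: less_imp_neq[symmetric]\<close>)
  then have eigs: "laplacian_eigenvalues G = proots (char_poly S)"
    by (simp add: laplacian_eigenvalues_def L_def[symmetric] char_poly_similar)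
  have form: "(\<Sum>k<n. \<Sum>l<n. (s k * f (vs ! k)) * S $$ (k, l) * (s l * h (vs ! l))) =
      (\<Sum>v\<in>W. real (graph_degree G v) * f v * h v) - (\<Sum>v\<in>W. \<Sum>w | w \<in> W \<and> {v, w} \<in> E. f v * h w)" for f h
  proof -
    have "(\<Sum>k<n. \<Sum>l<n. (s k * f (vs ! k)) * S $$ (k, l) * (s l * h (vs ! l))) =
        (\<Sum>k<n. \<Sum>l<n. (if l = k then m (vs ! k) * f (vs ! k) * h (vs ! k) else 0)
          - f (vs ! k) * (m (vs ! k) * ?a (vs ! k) (vs ! l) * h (vs ! l)))"
    proof (intro sum.cong refl)
      fix k l assume kl: "k \<in> {..<n}" "l \<in> {..<n}"
      have "(s k * f (vs ! k)) * S $$ (k, l) * (s l * h (vs ! l)) =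
          (s k * S $$ (k, l) * s l) * f (vs ! k) * h (vs ! l)"
        by simp
      also have "\<dots> = (if l = k then m (vs ! k) * f (vs ! k) * h (vs ! k) else 0)
          - f (vs ! k) * (m (vs ! k) * ?a (vs ! k) (vs ! l) * h (vs ! l))"
        using kl by (subst sSs) (auto simp: L_entry algebra_simps)
      finally show "(s k * f (vs ! k)) * S $$ (k, l) * (s l * h (vs ! l)) = \<dots>" .
    qed
    also have "\<dots> = (\<Sum>k<n. m (vs ! k) * f (vs ! k) * h (vs ! k)
        - f (vs ! k) * (\<Sum>w\<in>W. m (vs ! k) * ?a (vs ! k) w * h w))"
      by (simp add: sum_subtractf reindex flip: sum_distrib_left)
    also have "\<dots> = (\<Sum>v\<in>W. m v * f v * h v - f v * (\<Sum>w\<in>W. m v * ?a v w * h w))"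
      by (rule reindex[symmetric])
    also have "\<dots> = (\<Sum>v\<in>W. real (graph_degree G v) * f v * h v - (\<Sum>w | w \<in> W \<and> {v, w} \<in> E. f v * h w))"
    proof (intro sum.cong refl)
      fix v assume "v \<in> W"
      then show "m v * f v * h v - f v * (\<Sum>w\<in>W. m v * ?a v w * h w) =
          real (graph_degree G v) * f v * h v - (\<Sum>w | w \<in> W \<and> {v, w} \<in> E. f v * h w)"
        unfolding mf[OF \<open>v \<in> W\<close>] sum_distrib_left[symmetric]
        by (simp add: degm algebra_simps)
    qed
    finally show ?thesis by (simp add: sum_subtractf)
  qed
  \<comment> \<open>The rows of the averaging matrix sum to 1, so the Laplacian kills the constant
    1, which the conjugation turns into \<open>s\<close>.\<close>
  have ker: "(\<Sum>l<n. S $$ (k, l) * s l) = 0" if k: "k < n" for k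
  proof -
    have "s k * (\<Sum>l<n. S $$ (k, l) * s l) = (\<Sum>l<n. m (vs ! k) * L $$ (k, l))"
      using k by (simp add: sum_distrib_left sSs flip: mult.assoc)
    also have "\<dots> = (\<Sum>l<n. (if l = k then m (vs ! k) else 0) - m (vs ! k) * ?a (vs ! k) (vs ! l) * 1)"
      using k by (intro sum.cong) (auto simp: L_entry right_diff_distrib)
    also have "\<dots> = m (vs ! k) - (\<Sum>w\<in>W. m (vs ! k) * ?a (vs ! k) w * 1)"
      using k by (simp add: sum_subtractf reindex)
    also have "\<dots> = 0"
      using mf[OF memW[OF k], of "\<lambda>_. 1"] by (simp add: degm nbrs)
    finally show ?thesis using s(1)[of k] by simp
  qed
  have "n > 0" using False W by (simp add: n_def card_gt_0_iff)
  then have "\<exists>l<n. s l \<noteq> 0" using s(1)[of 0] by auto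
  obtain K :: "nat set" and \<psi> where K: "finite K" "Suc (card K) = size {#l \<in># proots (char_poly S). l \<le> \<alpha>#}"
    and gap: "\<And>g. (\<Sum>k<n. s k * g k) = 0 \<Longrightarrow> (\<And>i. i \<in> K \<Longrightarrow> (\<Sum>k<n. \<psi> i k * g k) = 0) \<Longrightarrow>
      \<exists>k<n. g k \<noteq> 0 \<Longrightarrow> \<alpha> * (\<Sum>k<n. (g k)\<^sup>2) < (\<Sum>k<n. \<Sum>l<n. g k * S $$ (k, l) * g l)"
    using symmetric_form_gap[OF S symS \<open>\<alpha> \<ge> 0\<close> ker \<open>\<exists>l<n. s l \<noteq> 0\<close>] by blast
  \<comment> \<open>\<open>inv_into\<close> recovers the position of a vertex in \<open>vs\<close>.
    The factor \<open>s k\<close> turns a condition on the rescaled vector \<open>?g\<close> below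
    into one on \<open>f\<close>.\<close>
  define \<phi> where "\<phi> i v = (let k = inv_into {..<n} (\<lambda>i. vs ! i) v in \<psi> i k * s k)" for i v
  have \<phi>: "\<phi> i (vs ! k) = \<psi> i k * s k" if "k < n" for i k
    using that bij by (simp add: \<phi>_def bij_betw_def)
  have "int (card K) = gamma G \<alpha>"
    using K False eigs[symmetric] by (simp add: gamma_def G_def)
  moreover have "\<alpha> * (\<Sum>v\<in>W. m v * (f v)\<^sup>2) <
        (\<Sum>v\<in>W. real (graph_degree G v) * (f v)\<^sup>2) - (\<Sum>v\<in>W. \<Sum>w | w \<in> W \<and> {v, w} \<in> E. f v * f w)"
    if f0: "(\<Sum>v\<in>W. m v * f v) = 0" and fK: "\<forall>i\<in>K. (\<Sum>v\<in>W. \<phi> i v * f v) = 0"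
      and nz: "\<exists>v\<in>W. f v \<noteq> 0" for f
  proof -
    let ?g = "\<lambda>k. s k * f (vs ! k)"
    have "(\<Sum>k<n. s k * ?g k) = (\<Sum>v\<in>W. m v * f v)"
      by (simp add: reindex s(2) flip: mult.assoc)
    moreover have "(\<Sum>k<n. \<psi> i k * ?g k) = (\<Sum>v\<in>W. \<phi> i v * f v)" for i
      by (simp add: reindex \<phi> flip: mult.assoc)
    moreover obtain k where "k < n" "f (vs ! k) \<noteq> 0"
      using nz vs len by (metis in_set_conv_nth)
    then have "\<exists>k<n. ?g k \<noteq> 0" using s(1)[of k] by auto
    moreover have "(\<Sum>k<n. (?g k)\<^sup>2) = (\<Sum>v\<in>W. m v * (f v)\<^sup>2)"
      by (simp add: reindex power_mult_distrib s(2) power2_eq_square[of "s _"])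
    ultimately have "\<alpha> * (\<Sum>v\<in>W. m v * (f v)\<^sup>2) < (\<Sum>k<n. \<Sum>l<n. ?g k * S $$ (k, l) * ?g l)"
      using gap[of ?g] f0 fK by simp
    then show ?thesis
      unfolding form by (simp add: power2_eq_square mult.assoc)
  qed
  ultimately show ?thesis
    using K(1) by blast
qed

section \<open>Counting linear conditions\<close>

text \<open>Gaussian elimination, one equation at a time: solving equation \<open>j\<close> for an
  unknown \<open>p\<close> that occurs in it and substituting gives the system \<open>a'\<close>,
  with one equation and one unknown fewer.\<close>

lemma underdetermined_system:
  fixes a :: "'s \<Rightarrow> 'j \<Rightarrow> real"
  assumes "finite J" "finite S" "card J < card S"
  shows "\<exists>c. (\<exists>s\<in>S. c s \<noteq> 0) \<and> (\<forall>j\<in>J. (\<Sum>s\<in>S. c s * a s j) = 0)"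
  using assms
proof (induction J arbitrary: S a rule: finite_induct)
  case empty
  then show ?case
    by (intro exI[of _ "\<lambda>_. 1"]) (auto simp: card_gt_0_iff)
next
  case (insert j J)
  show ?case
  proof (cases "\<forall>s\<in>S. a s j = 0")
    case True
    have "card J < card S" using insert by simp
    then obtain c where "\<exists>s\<in>S. c s \<noteq> 0" "\<forall>i\<in>J. (\<Sum>s\<in>S. c s * a s i) = 0"
      using insert.IH[OF insert.prems(1), of a] by blast
    with True show ?thesis by (intro exI[of _ c]) simp
  next
    case False
    then obtain p where p: "p \<in> S" "a p j \<noteq> 0" by blast
    define a' where "a' s i = a s i - a s j / a p j * a p i" for s i
    have "card J < card (S - {p})" using insert p by simp
    then obtain c where c: "\<exists>s\<in>S - {p}. c s \<noteq> 0" "\<And>i. i \<in> J \<Longrightarrow> (\<Sum>s\<in>S - {p}. c s * a' s i) = 0"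
      using insert.IH[of "S - {p}" a'] insert.prems(1) by auto
    \<comment> \<open>The value of the unknown \<open>p\<close> that equation \<open>j\<close>
      dictates.\<close>
    define r where "r = - (\<Sum>s\<in>S - {p}. c s * (a s j / a p j))"
    define c' where "c' = c(p := r)"
    have split: "(\<Sum>s\<in>S. c' s * a s i) = r * a p i + (\<Sum>s\<in>S - {p}. c s * a s i)" for i
      using p insert.prems(1) by (simp add: c'_def sum.remove)
    have "(\<Sum>s\<in>S. c' s * a s i) = 0" if "i \<in> insert j J" for i
    proof (cases "i = j")
      case True
      then show ?thesis
        using p by (simp add: split r_def sum_distrib_right)
    next
      case False
      then have "0 = (\<Sum>s\<in>S - {p}. c s * a' s i)" using that c by simp
      also have "\<dots> = (\<Sum>s\<in>S - {p}. c s * a s i) - (\<Sum>s\<in>S - {p}. c s * (a s j / a p j)) * a p i"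
        by (simp add: a'_def right_diff_distrib sum_subtractf sum_distrib_right mult.assoc)
      finally show ?thesis by (simp add: split r_def)
    qed
    moreover have "\<exists>s\<in>S. c' s \<noteq> 0"
      using c by (auto simp: c'_def)
    ultimately show ?thesis by blast
  qed
qed

text \<open>If a basis had more elements than \<open>\<Lambda>\<close>, a nontrivial combination of
  it would be annihilated by every functional and hence be zero, against independence.\<close>

lemma dim_le_card_functionals:
  fixes Z :: "'b::real_vector set" and \<Lambda> :: "('b \<Rightarrow> real) set"
  assumes "Real_Vector_Spaces.subspace Z" "finite \<Lambda>" and lin: "\<And>l. l \<in> \<Lambda> \<Longrightarrow> linear l"
    and sep: "\<And>z. z \<in> Z \<Longrightarrow> (\<And>l. l \<in> \<Lambda> \<Longrightarrow> l z = 0) \<Longrightarrow> z = 0"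
  shows "real_vector.dim Z \<le> card \<Lambda>"
proof (rule ccontr)
  assume "\<not> real_vector.dim Z \<le> card \<Lambda>"
  moreover obtain S where S: "S \<subseteq> Z" "independent S"
    "Z \<subseteq> span S" "card S = real_vector.dim Z"
    by (rule real_vector.basis_exists)
  ultimately have card: "card \<Lambda> < card S" by simp
  \<comment> \<open>An infinite set has \<open>card\<close> 0, which cannot exceed
    \<open>card \<Lambda>\<close>.\<close>
  then have "finite S" by (metis card.infinite not_less_zero)
  then obtain c where c: "\<exists>s\<in>S. c s \<noteq> 0" "\<And>l. l \<in> \<Lambda> \<Longrightarrow> (\<Sum>s\<in>S. c s * l s) = 0"
    using underdetermined_system[OF \<open>finite \<Lambda>\<close> \<open>finite S\<close> card, of "\<lambda>s l. l s"] by blast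
  define z where "z = (\<Sum>s\<in>S. c s *\<^sub>R s)"
  have "z \<in> Z"
    unfolding z_def using S(1) assms(1)
    by (intro real_vector.subspace_sum real_vector.subspace_scale) auto
  moreover have "l z = 0" if "l \<in> \<Lambda>" for l
    using c(2)[OF that] lin[OF that] by (simp add: z_def linear_sum linear_scale)
  ultimately have "z = 0" by (rule sep)
  then show False
    using c(1) S(2) \<open>finite S\<close> real_vector.independentD[of S S c] by (auto simp: z_def)
qed

section \<open>Chains on ordered simplices\<close>

text \<open>A coface is recorded by the vertex it adds, so the same set serves as the vertex set of
  the link.\<close>

definition cofaces :: "'a set set \<Rightarrow> 'a set \<Rightarrow> 'a set" where
  "cofaces X \<sigma> = {v. v \<notin> \<sigma> \<and> insert v \<sigma> \<in> X}"

text \<open>The index counts vertices, so it is the dimension plus one. Inserting the empty set puts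
  the empty list at index 0, in agreement with dimension -1.\<close>

definition ordered_simplices :: "'a set set \<Rightarrow> nat \<Rightarrow> 'a list set" where
  "ordered_simplices X n = {vs. distinct vs \<and> length vs = n \<and> set vs \<in> insert {} X}"

lemma simplicial_complexD:
  assumes "simplicial_complex V X"
  shows "finite (\<Union>X)" "{} \<notin> X" "\<sigma> \<in> X \<Longrightarrow> \<tau> \<noteq> {} \<Longrightarrow> \<tau> \<subseteq> \<sigma> \<Longrightarrow> \<tau> \<in> X"
proof -
  show "finite (\<Union>X)"
    by (rule finite_subset[of _ V]) (use assms in \<open>auto simp: simplicial_complex_def\<close>)
  show "{} \<notin> X" "\<sigma> \<in> X \<Longrightarrow> \<tau> \<noteq> {} \<Longrightarrow> \<tau> \<subseteq> \<sigma> \<Longrightarrow> \<tau> \<in> X"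
    using assms unfolding simplicial_complex_def by blast+
qed

lemma ordered_simplices_iff:
  assumes "simplicial_complex V X"
  shows "distinct vs \<and> set vs \<in> simplices X (int n - 1) \<longleftrightarrow> vs \<in> ordered_simplices X n"
  using simplicial_complexD(2)[OF assms]
  by (auto simp: ordered_simplices_def simplices_def distinct_card split: if_splits)

lemma ordered_simplices_Suc:
  assumes X: "simplicial_complex V X"
  shows "v # s \<in> ordered_simplices X (Suc n) \<longleftrightarrow> s \<in> ordered_simplices X n \<and> v \<in> cofaces X (set s)"
  using simplicial_complexD(3)[OF X, of "set (v # s)" "set s"]
  by (auto simp: ordered_simplices_def cofaces_def)

lemma finite_ordered_simplices:
  assumes "simplicial_complex V X"
  shows "finite (ordered_simplices X n)"
proof (rule finite_subset)
  show "ordered_simplices X n \<subseteq> {vs. set vs \<subseteq> \<Union>X \<and> length vs = n}"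
    by (auto simp: ordered_simplices_def)
qed (rule finite_lists_length_eq[OF simplicial_complexD(1)[OF assms]])

lemma finite_cofaces:
  assumes "simplicial_complex V X"
  shows "finite (cofaces X \<sigma>)"
  by (rule finite_subset[OF _ simplicial_complexD(1)[OF assms]]) (auto simp: cofaces_def)

text \<open>The localization step: splitting an ordering into head and tail turns a global sum into
  a sum, over the ordered faces \<open>s\<close>, of sums over the link vertices of
  \<open>s\<close>.\<close>

lemma sum_ordered_simplices_Suc:
  fixes F :: "'a list \<Rightarrow> real"
  assumes X: "simplicial_complex V X"
  shows "(\<Sum>r\<in>ordered_simplices X (Suc n). F r) =
    (\<Sum>s\<in>ordered_simplices X n. \<Sum>v\<in>cofaces X (set s). F (v # s))"
proof -
  have "(\<Sum>s\<in>ordered_simplices X n. \<Sum>v\<in>cofaces X (set s). F (v # s)) =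
      (\<Sum>(s, v)\<in>(SIGMA s:ordered_simplices X n. cofaces X (set s)). F (v # s))"
    by (rule sum.Sigma) (auto simp: finite_ordered_simplices[OF X] finite_cofaces[OF X])
  also have "\<dots> = (\<Sum>r\<in>ordered_simplices X (Suc n). F r)"
  proof (rule sum.reindex_bij_witness[of _ "\<lambda>r. (tl r, hd r)" "\<lambda>(s, v). v # s"])
    fix r assume r: "r \<in> ordered_simplices X (Suc n)"
    then obtain v s where "r = v # s"
      by (cases r) (auto simp: ordered_simplices_def)
    then show "(case (tl r, hd r) of (s, v) \<Rightarrow> v # s) = r"
      "(tl r, hd r) \<in> (SIGMA s:ordered_simplices X n. cofaces X (set s))"
      using r ordered_simplices_Suc[OF X, of v s n] by auto
  qed (use ordered_simplices_Suc[OF X] in auto)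
  finally show ?thesis by simp
qed

section \<open>Transpositions of list entries and alternating functions\<close>

definition list_swap :: "nat \<Rightarrow> nat \<Rightarrow> 'a list \<Rightarrow> 'a list" where
  "list_swap i j xs = xs[i := xs ! j, j := xs ! i]"

lemma list_swap_simps [simp]:
  "length (list_swap i j xs) = length xs"
  "list_swap i j xs = [] \<longleftrightarrow> xs = []"
  "i < length xs \<Longrightarrow> j < length xs \<Longrightarrow> set (list_swap i j xs) = set xs"
  "i < length xs \<Longrightarrow> j < length xs \<Longrightarrow> distinct (list_swap i j xs) = distinct xs"
  by (auto simp: list_swap_def)

lemma list_swap_involutory:
  "i < length xs \<Longrightarrow> j < length xs \<Longrightarrow> list_swap i j (list_swap i j xs) = xs"
  by (rule nth_equalityI) (auto simp: list_swap_def nth_list_update)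

lemma list_swap_update:
  assumes "a < length s" "b < length s"
  shows "(list_swap a b s)[k := x] = list_swap a b (s[transpose a b k := x])"
proof (rule nth_equalityI)
  fix i assume "i < length ((list_swap a b s)[k := x])"
  then show "(list_swap a b s)[k := x] ! i = list_swap a b (s[transpose a b k := x]) ! i"
    using assms by (cases "i = k") (auto simp: list_swap_def nth_list_update transpose_def)
qed simp

lemma list_swap_Cons_0:
  assumes "b < length s"
  shows "list_swap 0 (Suc b) (x # s) = s ! b # s[b := x]"
  using assms by (simp add: list_swap_def)

lemma list_swap_Cons_Suc: "list_swap (Suc a) (Suc b) (x # s) = x # list_swap a b s"
  by (simp add: list_swap_def)

definition alternating :: "('a list \<Rightarrow> real) \<Rightarrow> bool" where
  "alternating c \<longleftrightarrow> (\<forall>vs i j. i < j \<and> j < length vs \<longrightarrow> c (list_swap i j vs) = - c vs)"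

lemma alternatingD:
  assumes "alternating c" "i \<noteq> j" "i < length vs" "j < length vs"
  shows "c (list_swap i j vs) = - c vs"
proof (cases "i < j")
  case False
  then have "list_swap i j vs = list_swap j i vs"
    using assms by (simp add: list_swap_def list_update_swap)
  then show ?thesis using False assms by (simp add: alternating_def)
qed (use assms in \<open>simp add: alternating_def\<close>)

lemma simplicial_chains_iff:
  assumes "simplicial_complex V X"
  shows "c \<in> simplicial_chains X (int n - 1) \<longleftrightarrow>
    alternating c \<and> (\<forall>vs. vs \<notin> ordered_simplices X n \<longrightarrow> c vs = 0)"
  unfolding simplicial_chains_def alternating_def list_swap_def
  using ordered_simplices_iff[OF assms] by blast

text \<open>The factor is the sign of the rearrangement, and what matters is that it does not depend
  on \<open>v\<close>: a linear condition on \<open>v \<mapsto> c (v # s)\<close> carries over to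
  every other ordering of \<open>s\<close>. The prefix \<open>p\<close> holds the entries that the
  induction has already put in place.\<close>

lemma alternating_permute:
  assumes "alternating c" "mset s = mset t"
  shows "\<exists>\<epsilon>. \<forall>v. c (v # p @ t) = \<epsilon> * c (v # p @ s)"
  using assms(2)
proof (induction t arbitrary: s p)
  case Nil
  then show ?case by (intro exI[of _ 1]) simp
next
  case (Cons a t)
  then have "a \<in> set s" by (metis list.set_intros(1) set_mset_mset)
  then obtain j where j: "j < length s" "s ! j = a" by (auto simp: in_set_conv_nth)
  \<comment> \<open>One swap brings the required first entry \<open>a\<close> to the front; the rest
    is left to the induction hypothesis.\<close>
  define s' where "s' = list_swap 0 j s"
  have "s' \<noteq> []" "hd s' = a"
    using j by (auto simp: s'_def list_swap_def hd_conv_nth nth_list_update simp flip: length_0_conv)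
  then obtain r where r: "s' = a # r" by (cases s') auto
  have "mset s' = mset s"
    using j by (auto simp: s'_def list_swap_def intro: mset_swap)
  then have "mset r = mset t" using Cons.prems r by simp
  from Cons.IH[OF this, of "p @ [a]"] obtain \<epsilon> where
    \<epsilon>: "\<And>v. c (v # p @ a # t) = \<epsilon> * c (v # p @ s')"
    using r by auto
  have "\<exists>\<delta>. \<forall>v. c (v # p @ s') = \<delta> * c (v # p @ s)"
  proof (cases "j = 0")
    case True
    then have "s' = s" by (simp add: s'_def list_swap_def)
    then show ?thesis by (intro exI[of _ 1]) simp
  next
    case False
    have "v # p @ s' = list_swap (Suc (length p)) (Suc (length p + j)) (v # p @ s)" for v
      using j by (simp add: s'_def list_swap_def list_update_append nth_append)
    then show ?thesis
      using alternatingD[OF assms(1), of "Suc (length p)" "Suc (length p + j)"] False j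
      by (intro exI[of _ "-1"]) simp
  qed
  then obtain \<delta> where "\<And>v. c (v # p @ s') = \<delta> * c (v # p @ s)" by blast
  with \<epsilon> show ?case by (intro exI[of _ "\<epsilon> * \<delta>"]) simp
qed

section \<open>The coboundary of an alternating function\<close>

text \<open>Deleting \<open>s ! i\<close> from \<open>x # s\<close> gives a rearrangement of \<open>s[i := x]\<close>, so for alternating \<open>h\<close> this is
  the usual coboundary, restricted to the simplices of \<open>X\<close>.\<close>

definition coboundary :: "'a set set \<Rightarrow> nat \<Rightarrow> ('a list \<Rightarrow> real) \<Rightarrow> 'a list \<Rightarrow> real" where
  "coboundary X n h r =
    (if r \<in> ordered_simplices X (Suc n) then h (tl r) - (\<Sum>i<n. h ((tl r)[i := hd r])) else 0)"

text \<open>Swapping the head with tail entry \<open>b\<close> exchanges the leading term with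
  summand \<open>b\<close>, and in every other summand \<open>k\<close> it acts as a swap of
  positions \<open>k\<close> and \<open>b\<close>. Swapping two tail entries negates each term and
  permutes the summands.\<close>

lemma coboundary_alternating:
  assumes h: "alternating h"
  shows "alternating (coboundary X n h)"
  unfolding alternating_def
proof (intro allI impI, elim conjE)
  fix r :: "'a list" and i j assume ij: "i < j" "j < length r"
  let ?e = "coboundary X n h"
  have mem: "list_swap i j r \<in> ordered_simplices X (Suc n) \<longleftrightarrow> r \<in> ordered_simplices X (Suc n)"
    using ij by (simp add: ordered_simplices_def)
  show "?e (list_swap i j r) = - ?e r"
  proof (cases "r \<in> ordered_simplices X (Suc n)")
    case False
    then show ?thesis using mem by (simp add: coboundary_def)
  next
    case True
    then obtain x s where r: "r = x # s" and len: "length s = n"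
      by (cases r) (auto simp: ordered_simplices_def)
    obtain b where b: "j = Suc b" "b < n" using ij r len by (cases j) auto
    have e_r: "?e r = h s - (\<Sum>k<n. h (s[k := x]))"
      using True r by (simp add: coboundary_def)
    show ?thesis
    proof (cases i)
      case 0
      have "h (s[b := x, k := s ! b]) = - h (s[k := x])" if "k < n" "k \<noteq> b" for k
      proof -
        have "s[b := x, k := s ! b] = list_swap k b (s[k := x])"
          using that b len by (simp add: list_swap_def list_update_swap)
        then show ?thesis using alternatingD[OF h, of k b "s[k := x]"] that b len by simp
      qed
      then have "(\<Sum>k\<in>{..<n} - {b}. h (s[b := x, k := s ! b])) = - (\<Sum>k\<in>{..<n} - {b}. h (s[k := x]))"
        by (simp add: sum_negf)
      moreover have "(\<Sum>k<n. F k) = F b + (\<Sum>k\<in>{..<n} - {b}. F k)" for F :: "nat \<Rightarrow> real"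
        using b by (intro sum.remove) auto
      moreover have "?e (list_swap i j r) = h (s[b := x]) - (\<Sum>k<n. h (s[b := x, k := s ! b]))"
        using True mem 0 b len by (simp add: coboundary_def r list_swap_Cons_0)
      ultimately show ?thesis
        by (simp add: e_r)
    next
      case (Suc a)
      then have a: "a < n" "a \<noteq> b" using ij b by auto
      have swap: "h (list_swap a b s') = - h s'" if "length s' = n" for s'
        using alternatingD[OF h, of a b s'] a b that by simp
      have "(\<Sum>k<n. h ((list_swap a b s)[k := x])) = - (\<Sum>k<n. h (s[transpose a b k := x]))"
        using a b len by (simp add: list_swap_update swap sum_negf)
      also have "(\<Sum>k<n. h (s[transpose a b k := x])) = (\<Sum>k<n. h (s[k := x]))"
        by (rule sum.reindex_bij_witness[of _ "transpose a b" "transpose a b"])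
          (use a b in \<open>auto simp: transpose_def\<close>)
      finally show ?thesis
        using True mem Suc b len
        by (simp add: e_r) (simp add: coboundary_def r list_swap_Cons_Suc swap)
    qed
  qed
qed

section \<open>Garland's identity\<close>

text \<open>After expanding the coboundary, all \<open>n\<close> face terms have the same sum:
  swapping entries 0 and \<open>i\<close> of the tail carries face \<open>i\<close> to face 0 and
  negates both factors, so the signs cancel. Summing over all orderings makes this a mere
  reindexing.\<close>

lemma coboundary_pairing_product:
  assumes h: "alternating h"
  shows "(\<Sum>r\<in>ordered_simplices X (Suc n). h (tl r) * coboundary X n h r) =
    (\<Sum>r\<in>ordered_simplices X (Suc n). (h (tl r))\<^sup>2) -
    real n * (\<Sum>r\<in>ordered_simplices X (Suc n). h (tl r) * h ((tl r)[0 := hd r]))"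
proof -
  let ?Q = "ordered_simplices X (Suc n)"
  have all_eq: "(\<Sum>r\<in>?Q. h (tl r) * h ((tl r)[i := hd r])) = (\<Sum>r\<in>?Q. h (tl r) * h ((tl r)[0 := hd r]))"
    if "i < n" for i
  proof (cases "i = 0")
    case False
    let ?sw = "\<lambda>r. list_swap 1 (Suc i) r :: 'a list"
    show ?thesis
    proof (rule sum.reindex_bij_witness[of _ ?sw ?sw])
      fix r assume r: "r \<in> ?Q"
      then have len: "length r = Suc n" by (simp add: ordered_simplices_def)
      show "?sw (?sw r) = r"
        using len that False by (intro list_swap_involutory) auto
      show "?sw r \<in> ?Q"
        using r that by (simp add: ordered_simplices_def)
      obtain x s where xs: "r = x # s" and "length s = n" using len by (cases r) auto
      then have swap: "h (list_swap 0 i s') = - h s'" if "length s' = n" for s'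
        using alternatingD[OF h, of 0 i s'] \<open>i < n\<close> False that by simp
      show "h (tl (?sw r)) * h ((tl (?sw r))[0 := hd (?sw r)]) = h (tl r) * h ((tl r)[i := hd r])"
        using that \<open>length s = n\<close> unfolding xs
        by (simp add: list_swap_Cons_Suc list_swap_update swap)
    next
      fix r assume r: "r \<in> ?Q"
      then have len: "length r = Suc n" by (simp add: ordered_simplices_def)
      show "?sw (?sw r) = r"
        using len that False by (intro list_swap_involutory) auto
      show "?sw r \<in> ?Q"
        using r that by (simp add: ordered_simplices_def)
    qed
  qed simp
  have "(\<Sum>r\<in>?Q. h (tl r) * coboundary X n h r) =
      (\<Sum>r\<in>?Q. (h (tl r))\<^sup>2 - (\<Sum>i<n. h (tl r) * h ((tl r)[i := hd r])))"
    by (intro sum.cong refl)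
      (simp add: coboundary_def right_diff_distrib sum_distrib_left power2_eq_square)
  also have "\<dots> = (\<Sum>r\<in>?Q. (h (tl r))\<^sup>2) - (\<Sum>i<n. \<Sum>r\<in>?Q. h (tl r) * h ((tl r)[i := hd r]))"
    unfolding sum_subtractf by (subst sum.swap) simp
  also have "(\<Sum>i<n. \<Sum>r\<in>?Q. h (tl r) * h ((tl r)[i := hd r])) =
      (\<Sum>i<n. \<Sum>r\<in>?Q. h (tl r) * h ((tl r)[0 := hd r]))"
    by (intro sum.cong refl all_eq) simp
  finally show ?thesis by simp
qed

text \<open>\<open>cocycle\<close> asks only that \<open>h\<close> pairs to zero with the boundary
  of its coboundary. This pairing expands to N - (j + 1) P, where \<open>N\<close> is the squared
  norm weighted by numbers of cofaces and \<open>P\<close> sums the products over adjacent vertices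
  of links. So P = N / (j + 1), and the total energy N - P is the stated multiple of
  \<open>N\<close>.\<close>

lemma garland_identity:
  assumes X: "simplicial_complex V X" and h: "alternating h"
    and cocycle: "(\<Sum>s\<in>ordered_simplices X (Suc j). h s * simplicial_boundary X (coboundary X (Suc j) h) s) = 0"
  shows "(\<Sum>t\<in>ordered_simplices X j.
      (\<Sum>v\<in>cofaces X (set t). real (card (cofaces X (insert v (set t)))) * (h (v # t))\<^sup>2) -
      (\<Sum>v\<in>cofaces X (set t). \<Sum>w\<in>cofaces X (insert v (set t)). h (v # t) * h (w # t))) =
    (1 - 1 / real (Suc j)) * (\<Sum>t\<in>ordered_simplices X j.
      \<Sum>v\<in>cofaces X (set t). real (card (cofaces X (insert v (set t)))) * (h (v # t))\<^sup>2)"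
proof -
  let ?n = "Suc j"
  let ?Q = "ordered_simplices X (Suc ?n)"
  note sum_Suc = sum_ordered_simplices_Suc[OF X]
  define N where "N = (\<Sum>r\<in>?Q. (h (tl r))\<^sup>2)"
  define P where "P = (\<Sum>r\<in>?Q. h (tl r) * h ((tl r)[0 := hd r]))"
  have N: "N = (\<Sum>t\<in>ordered_simplices X j.
      \<Sum>v\<in>cofaces X (set t). real (card (cofaces X (insert v (set t)))) * (h (v # t))\<^sup>2)"
    by (simp add: N_def sum_Suc)
  \<comment> \<open>For r = w # v # t, replacing the first entry of the tail by the head gives w #
    t, so the two factors are values of the same link function at the ends of an edge.\<close>
  have P: "P = (\<Sum>t\<in>ordered_simplices X j.
      \<Sum>v\<in>cofaces X (set t). \<Sum>w\<in>cofaces X (insert v (set t)). h (v # t) * h (w # t))"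
    by (simp add: P_def sum_Suc)
  have "simplicial_boundary X (coboundary X ?n h) s =
      (\<Sum>v\<in>cofaces X (set s). coboundary X ?n h (v # s))"
    if "s \<in> ordered_simplices X ?n" for s
    unfolding simplicial_boundary_def
  proof (rule sum.mono_neutral_right[OF simplicial_complexD(1)[OF X]])
    show "\<forall>v\<in>\<Union>X - cofaces X (set s). coboundary X ?n h (v # s) = 0"
      using ordered_simplices_Suc[OF X, of _ s ?n] by (simp add: coboundary_def)
  qed (auto simp: cofaces_def)
  then have "0 = (\<Sum>s\<in>ordered_simplices X ?n. \<Sum>v\<in>cofaces X (set s). h s * coboundary X ?n h (v # s))"
    using cocycle by (simp add: sum_distrib_left)
  also have "\<dots> = (\<Sum>r\<in>?Q. h (tl r) * coboundary X ?n h r)"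
    by (simp only: sum_Suc[where n = ?n] list.sel)
  finally have "N = real ?n * P"
    unfolding coboundary_pairing_product[OF h] N_def P_def by simp
  then have "P = N / real ?n" by simp
  then have "N - P = (1 - 1 / real ?n) * N"
    by (simp only: left_diff_distrib mult_1_left times_divide_eq_left)
  then show ?thesis
    unfolding N P sum_subtractf .
qed

text \<open>In the 1-skeleton of the link of \<tau> the vertices are the cofaces of \<tau>, and the
  neighbours of \<open>v\<close> are the cofaces of \<open>insert v \<tau>\<close>. Degrees in the
  link are thus coface numbers in \<open>X\<close>, and the spectral gap for graphs
  translates.\<close>

lemma link_functionals:
  assumes X: "simplicial_complex V X" and "\<alpha> \<ge> 0"
  defines "m \<equiv> \<lambda>\<sigma>. real (max 1 (card (cofaces X \<sigma>)))"
  shows "\<exists>(K :: nat set) \<phi>. finite K \<and> int (card K) = gamma (skeleton1 (link X \<tau>)) \<alpha> \<and>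
    (\<forall>f. (\<Sum>v\<in>cofaces X \<tau>. m (insert v \<tau>) * f v) = 0 \<longrightarrow>
      (\<forall>i\<in>K. (\<Sum>v\<in>cofaces X \<tau>. \<phi> i v * f v) = 0) \<longrightarrow> (\<exists>v\<in>cofaces X \<tau>. f v \<noteq> 0) \<longrightarrow>
      \<alpha> * (\<Sum>v\<in>cofaces X \<tau>. m (insert v \<tau>) * (f v)\<^sup>2) <
        (\<Sum>v\<in>cofaces X \<tau>. real (card (cofaces X (insert v \<tau>))) * (f v)\<^sup>2) -
        (\<Sum>v\<in>cofaces X \<tau>. \<Sum>w\<in>cofaces X (insert v \<tau>). f v * f w))"
proof -
  let ?W = "cofaces X \<tau>"
  define E where "E = simplices (link X \<tau>) 1"
  have vertex: "{v} \<in> link X \<tau> \<longleftrightarrow> v \<in> ?W" for v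
    using simplicial_complexD(3)[OF X, of "insert v \<tau>" "{v}"] by (auto simp: link_def cofaces_def)
  have "\<Union> (simplices (link X \<tau>) 0) = {v. {v} \<in> link X \<tau>}"
  proof (intro equalityI subsetI)
    fix v assume "v \<in> \<Union> (simplices (link X \<tau>) 0)"
    then obtain \<sigma> where "v \<in> \<sigma>" "\<sigma> \<in> link X \<tau>" "card \<sigma> = 1"
      by (auto simp: simplices_def)
    then show "v \<in> {v. {v} \<in> link X \<tau>}" by (metis card_1_singletonE mem_Collect_eq singletonD)
  qed (auto simp: simplices_def intro!: bexI[of _ "{_}"])
  then have skel: "skeleton1 (link X \<tau>) = (?W, E)"
    by (simp add: skeleton1_def E_def vertex)
  have nbrs: "{w \<in> ?W. {v, w} \<in> E} = cofaces X (insert v \<tau>)" if "v \<in> ?W" for v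
  proof (intro equalityI subsetI)
    fix w assume "w \<in> {w \<in> ?W. {v, w} \<in> E}"
    then show "w \<in> cofaces X (insert v \<tau>)"
      by (cases "v = w") (auto simp: E_def simplices_def link_def cofaces_def insert_commute)
  next
    fix w assume "w \<in> cofaces X (insert v \<tau>)"
    then have w: "w \<noteq> v" "w \<notin> \<tau>" "insert w (insert v \<tau>) \<in> X" by (auto simp: cofaces_def)
    then have "insert w \<tau> \<in> X" "{v, w} \<in> X"
      using simplicial_complexD(3)[OF X w(3), of "insert w \<tau>"]
        simplicial_complexD(3)[OF X w(3), of "{v, w}"] by auto
    then show "w \<in> {w \<in> ?W. {v, w} \<in> E}"
      using w that by (auto simp: E_def simplices_def link_def cofaces_def insert_commute)
  qed
  have degree: "graph_degree (?W, E) v = card (cofaces X (insert v \<tau>))" if "v \<in> ?W" for v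
    using nbrs[OF that] by (simp add: graph_degree_def)
  have noloop: "{v} \<notin> E" for v by (simp add: E_def simplices_def)
  obtain K :: "nat set" and \<phi> where K: "finite K" "int (card K) = gamma (?W, E) \<alpha>" and gap:
    "\<forall>f. (\<Sum>v\<in>?W. real (max 1 (graph_degree (?W, E) v)) * f v) = 0 \<longrightarrow>
      (\<forall>i\<in>K. (\<Sum>v\<in>?W. \<phi> i v * f v) = 0) \<longrightarrow> (\<exists>v\<in>?W. f v \<noteq> 0) \<longrightarrow>
      \<alpha> * (\<Sum>v\<in>?W. real (max 1 (graph_degree (?W, E) v)) * (f v)\<^sup>2) <
        (\<Sum>v\<in>?W. real (graph_degree (?W, E) v) * (f v)\<^sup>2) -
        (\<Sum>v\<in>?W. \<Sum>w | w \<in> ?W \<and> {v, w} \<in> E. f v * f w)"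
    using laplacian_functionals[of ?W E \<alpha>, OF finite_cofaces[OF X] noloop \<open>\<alpha> \<ge> 0\<close>]
    by (elim exE conjE) (rule that)
  have rest: "\<alpha> * (\<Sum>v\<in>?W. m (insert v \<tau>) * (f v)\<^sup>2) <
        (\<Sum>v\<in>?W. real (card (cofaces X (insert v \<tau>))) * (f v)\<^sup>2) -
        (\<Sum>v\<in>?W. \<Sum>w\<in>cofaces X (insert v \<tau>). f v * f w)"
    if "(\<Sum>v\<in>?W. m (insert v \<tau>) * f v) = 0"
      "\<forall>i\<in>K. (\<Sum>v\<in>?W. \<phi> i v * f v) = 0" "\<exists>v\<in>?W. f v \<noteq> 0" for f
  proof -
    have "(\<Sum>v\<in>?W. real (max 1 (graph_degree (?W, E) v)) * g v) = (\<Sum>v\<in>?W. m (insert v \<tau>) * g v)" for g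
      by (intro sum.cong refl) (simp only: m_def degree)
    moreover have "(\<Sum>v\<in>?W. real (graph_degree (?W, E) v) * (f v)\<^sup>2) =
        (\<Sum>v\<in>?W. real (card (cofaces X (insert v \<tau>))) * (f v)\<^sup>2)"
      by (intro sum.cong refl) (simp only: degree)
    moreover have "(\<Sum>v\<in>?W. \<Sum>w | w \<in> ?W \<and> {v, w} \<in> E. f v * f w) =
        (\<Sum>v\<in>?W. \<Sum>w\<in>cofaces X (insert v \<tau>). f v * f w)"
      by (intro sum.cong refl) (simp only: nbrs)
    ultimately show ?thesis
      using gap[rule_format, of f] that by simp
  qed
  show ?thesis
    unfolding skel
    by (rule exI[of _ K], rule exI[of _ \<phi>], intro conjI allI impI) (fact K rest)+
qed

section \<open>The Betti number bound\<close>

lemma sum_fun_apply: "(\<Sum>s\<in>A. F s) x = (\<Sum>s\<in>A. F s x)"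
  for F :: "'s \<Rightarrow> 'b \<Rightarrow> real"
  by (induction A rule: infinite_finite_induct) auto

lemma linear_weighted_evaluation:
  "linear (\<lambda>c :: 'b \<Rightarrow> real. \<Sum>s\<in>A. a s * c (g s))"
  by (rule linearI)
    (simp_all add: scaleR_fun_def sum.distrib distrib_left sum_distrib_left mult.left_commute)

lemma subspace_simplicial_cycles:
  assumes X: "simplicial_complex V X"
  shows "Real_Vector_Spaces.subspace (simplicial_cycles X (int n - 1))"
proof (rule real_vector.subspaceI)
  show "0 \<in> simplicial_cycles X (int n - 1)"
    by (simp add: simplicial_cycles_def simplicial_chains_iff[OF X] alternating_def
        simplicial_boundary_def zero_fun_def)
  fix x y assume xy: "x \<in> simplicial_cycles X (int n - 1)" "y \<in> simplicial_cycles X (int n - 1)"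
  then have "simplicial_boundary X x vs = 0" "simplicial_boundary X y vs = 0" for vs
    by (simp_all add: simplicial_cycles_def)
  then show "x + y \<in> simplicial_cycles X (int n - 1)"
    using xy by (auto simp: simplicial_cycles_def simplicial_chains_iff[OF X] alternating_def
        simplicial_boundary_def sum.distrib)
next
  fix r and x assume x: "x \<in> simplicial_cycles X (int n - 1)"
  then have "simplicial_boundary X x vs = 0" for vs
    by (simp add: simplicial_cycles_def)
  then show "r *\<^sub>R x \<in> simplicial_cycles X (int n - 1)"
    using x by (auto simp: simplicial_cycles_def simplicial_chains_iff[OF X] alternating_def
        simplicial_boundary_def scaleR_fun_def simp flip: sum_distrib_left)
qed

text \<open>Chains are supported on finitely many lists and so lie in the span of the point masses
  \<delta>, which need not be alternating themselves. This makes a basis of the boundaries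
  finite.\<close>

lemma finite_independent_simplicial_chains:
  assumes X: "simplicial_complex V X"
    and S: "independent S" "S \<subseteq> simplicial_chains X (int n - 1)"
  shows "finite S"
proof -
  define \<delta> :: "'a list \<Rightarrow> 'a list \<Rightarrow> real" where "\<delta> s vs = (if vs = s then 1 else 0)" for s vs
  have "c \<in> span (\<delta> ` ordered_simplices X n)" if "c \<in> simplicial_chains X (int n - 1)" for c
  proof -
    have "c = (\<Sum>s\<in>ordered_simplices X n. c s *\<^sub>R \<delta> s)"
    proof
      fix vs
      have "(\<Sum>s\<in>ordered_simplices X n. c s *\<^sub>R \<delta> s) vs =
          (\<Sum>s\<in>ordered_simplices X n. if s = vs then c vs else 0)"
        unfolding sum_fun_apply by (intro sum.cong) (auto simp: scaleR_fun_def \<delta>_def)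
      also have "\<dots> = c vs"
        using that finite_ordered_simplices[OF X] by (auto simp: simplicial_chains_iff[OF X])
      finally show "c vs = (\<Sum>s\<in>ordered_simplices X n. c s *\<^sub>R \<delta> s) vs" by simp
    qed
    also have "\<dots> \<in> span (\<delta> ` ordered_simplices X n)"
      by (intro real_vector.span_sum real_vector.span_scale real_vector.span_base imageI)
    finally show ?thesis .
  qed
  then show ?thesis
    using real_vector.independent_span_bound[of "\<delta> ` ordered_simplices X n" S] S finite_ordered_simplices[OF X]
    by blast
qed

theorem theorem2p5:
  fixes V :: "'a set" and X :: "'a set set" and D :: int
  assumes "simplicial_complex V X"
    and "D \<ge> 1"
  shows "betti X (D - 1) \<le>
    (\<Sum>\<tau>\<in>simplices X (D - 2). gamma (skeleton1 (link X \<tau>)) (1 - inverse (real_of_int D)))"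
proof -
  note X = assms(1)
  \<comment> \<open>\<open>j\<close> and \<open>n\<close> are the numbers of vertices of simplices
    of dimension D - 2 and D - 1, so \<open>n\<close> equals \<open>D\<close>.\<close>
  define j where "j = nat (D - 1)"
  define n where "n = Suc j"
  have D: "D = int n" "D - 1 = int n - 1" "D - 2 = int j - 1" "D = int (Suc n) - 1"
    using assms(2) by (auto simp: n_def j_def)
  define \<alpha> where "\<alpha> = 1 - inverse (real_of_int D)"
  have \<alpha>: "\<alpha> = 1 - 1 / real n" "\<alpha> \<ge> 0"
    using D(1) by (auto simp: \<alpha>_def n_def inverse_eq_divide)
  let ?O = "ordered_simplices X" and ?T = "simplices X (D - 2)"
  define d where "d \<sigma> = real (card (cofaces X \<sigma>))" for \<sigma>
  \<comment> \<open>\<open>w\<close> differs from \<open>d\<close> only at simplices without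
    cofaces, where the value 1 keeps division by \<open>w\<close> possible.\<close>
  define w where "w \<sigma> = real (max 1 (card (cofaces X \<sigma>)))" for \<sigma>
  have w: "w \<sigma> > 0" "d \<sigma> \<le> w \<sigma>" for \<sigma>
    by (auto simp: w_def d_def)
  define energy where "energy \<tau> f = (\<Sum>v\<in>cofaces X \<tau>. d (insert v \<tau>) * (f v)\<^sup>2) -
    (\<Sum>v\<in>cofaces X \<tau>. \<Sum>u\<in>cofaces X (insert v \<tau>). f v * f u)" for \<tau> and f :: "'a \<Rightarrow> real"
  define separates where "separates \<tau> K \<phi> \<longleftrightarrow> finite K \<and>
    int (card K) = gamma (skeleton1 (link X \<tau>)) \<alpha> \<and>
    (\<forall>f. (\<Sum>v\<in>cofaces X \<tau>. w (insert v \<tau>) * f v) = 0 \<longrightarrow>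
      (\<forall>i\<in>K. (\<Sum>v\<in>cofaces X \<tau>. \<phi> i v * f v) = 0) \<longrightarrow> (\<exists>v\<in>cofaces X \<tau>. f v \<noteq> 0) \<longrightarrow>
      \<alpha> * (\<Sum>v\<in>cofaces X \<tau>. w (insert v \<tau>) * (f v)\<^sup>2) < energy \<tau> f)"
    for \<tau> and K :: "nat set" and \<phi> :: "nat \<Rightarrow> 'a \<Rightarrow> real"
  have "\<exists>K \<phi>. separates \<tau> K \<phi>" for \<tau>
    unfolding separates_def energy_def d_def w_def by (rule link_functionals[OF X \<alpha>(2)])
  then obtain K \<phi> where sep: "\<And>\<tau>. separates \<tau> (K \<tau>) (\<phi> \<tau>)" by metis
  have "\<exists>t. t \<in> ?O j \<and> set t = \<tau>" if "\<tau> \<in> ?T" for \<tau>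
  proof -
    have "\<tau> \<subseteq> \<Union>X" using that by (auto simp: simplices_def split: if_splits)
    then have "finite \<tau>" using simplicial_complexD(1)[OF X] by (rule finite_subset)
    then obtain t where "set t = \<tau>" "distinct t" using finite_distinct_list by blast
    then show ?thesis
      using ordered_simplices_iff[OF X, of t j] that D(3) by auto
  qed
  \<comment> \<open>Fixing one ordering of each \<tau> imposes the link conditions once per simplex,
    as the bound requires, and not once per ordering.\<close>
  then obtain rep where rep: "\<And>\<tau>. \<tau> \<in> ?T \<Longrightarrow> rep \<tau> \<in> ?O j \<and> set (rep \<tau>) = \<tau>" by metis
  have "?T \<subseteq> set ` ?O j"
    using rep by (metis image_eqI subsetI)
  then have "finite ?T"
    using finite_ordered_simplices[OF X] by (metis finite_imageI finite_subset)
  let ?Z = "simplicial_cycles X (D - 1)" and ?B = "simplicial_boundaries X (D - 1)"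
  obtain \<beta> where \<beta>: "\<beta> \<subseteq> ?B" "independent \<beta>" "?B \<subseteq> span \<beta>" "card \<beta> = real_vector.dim ?B"
    by (rule real_vector.basis_exists)
  have "?B \<subseteq> ?Z" using boundaries_subset_cycles[OF X] assms(2) by simp
  then have "finite \<beta>"
    using \<beta>(1,2) D(2) by (intro finite_independent_simplicial_chains[OF X, of \<beta> n])
      (auto simp: simplicial_cycles_def)
  \<comment> \<open>\<open>P b\<close> is the weighted inner product with the boundary
    \<open>b\<close>. \<open>Q (\<tau>, k)\<close> is the \<open>k\<close>-th link condition on the
    function that \<open>c / w\<close> induces on the link of \<tau>.\<close>
  define P where "P b c = (\<Sum>s\<in>?O n. b s / w (set s) * c s)" for b c :: "'a list \<Rightarrow> real"
  define Q where "Q = (\<lambda>(\<tau>, k) c. \<Sum>v\<in>cofaces X \<tau>. \<phi> \<tau> k v / w (insert v \<tau>) * c (v # rep \<tau>))"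
  define \<Lambda> where "\<Lambda> = P ` \<beta> \<union> Q ` Sigma ?T K"
  have finK: "finite (K \<tau>)" for \<tau> using sep by (simp add: separates_def)
  have "real_vector.dim ?Z \<le> card \<Lambda>"
  proof (rule dim_le_card_functionals)
    show "Real_Vector_Spaces.subspace ?Z"
      unfolding D(2) by (rule subspace_simplicial_cycles[OF X])
    show "finite \<Lambda>"
      using \<open>finite \<beta>\<close> \<open>finite ?T\<close> finK by (simp add: \<Lambda>_def)
    have "linear (P b)" for b
      unfolding P_def by (rule linear_weighted_evaluation)
    moreover have "linear (Q q)" for q
      unfolding Q_def by (cases q) (simp only: prod.case linear_weighted_evaluation)
    ultimately show "linear l" if "l \<in> \<Lambda>" for l
      using that by (auto simp: \<Lambda>_def)
  next
    fix c assume cZ: "c \<in> ?Z" and vanish: "\<And>l. l \<in> \<Lambda> \<Longrightarrow> l c = 0"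
    have c: "alternating c" "\<And>vs. vs \<notin> ?O n \<Longrightarrow> c vs = 0"
      using cZ by (auto simp: simplicial_cycles_def D(2) simplicial_chains_iff[OF X])
    define h where "h vs = c vs / w (set vs)" for vs
    have h: "alternating h"
      using c(1) by (auto simp: alternating_def h_def)
    have "P b h' = 0" if "b \<in> \<beta>" "h' = c" for b h'
      using that vanish by (auto simp: \<Lambda>_def)
    then have "(\<Sum>s\<in>?O n. h s * b s) = 0" if "b \<in> \<beta>" for b
      using that by (simp add: P_def h_def mult.commute)
    \<comment> \<open>Orthogonality to the basis \<beta> extends by linearity to this particular
      boundary, which is the input to the Garland identity.\<close>
    moreover have "simplicial_boundary X (coboundary X n h) \<in> span \<beta>"
    proof -
      have "coboundary X n h \<in> simplicial_chains X D"
        using coboundary_alternating[OF h]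
        unfolding D(4) simplicial_chains_iff[OF X] by (simp add: coboundary_def)
      then show ?thesis
        using \<beta>(3) by (auto simp: simplicial_boundaries_def)
    qed
    ultimately have "(\<Sum>s\<in>?O n. h s * simplicial_boundary X (coboundary X n h) s) = 0"
      using linear_eq_0_on_span[of "\<lambda>b. \<Sum>s\<in>?O n. h s * b s" \<beta>]
        linear_weighted_evaluation[of h "\<lambda>s. s"] by blast
    then have energy_sum: "(\<Sum>t\<in>?O j. energy (set t) (\<lambda>v. h (v # t))) =
        \<alpha> * (\<Sum>t\<in>?O j. \<Sum>v\<in>cofaces X (set t). d (insert v (set t)) * (h (v # t))\<^sup>2)"
      unfolding energy_def d_def \<alpha>(1) n_def by (rule garland_identity[OF X h])
    have gap: "\<alpha> * (\<Sum>v\<in>cofaces X (set t). w (insert v (set t)) * (h (v # t))\<^sup>2) <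
        energy (set t) (\<lambda>v. h (v # t))"
      if t: "t \<in> ?O j" and nz: "\<exists>v\<in>cofaces X (set t). h (v # t) \<noteq> 0" for t
    proof -
      let ?\<tau> = "set t"
      have \<tau>: "?\<tau> \<in> ?T"
        using ordered_simplices_iff[OF X, of t j] t D(3) by simp
      \<comment> \<open>The weight cancels the division in \<open>h\<close>, so orthogonality to the
        constants is the cycle condition at \<open>t\<close>.\<close>
      have "(\<Sum>v\<in>cofaces X ?\<tau>. w (insert v ?\<tau>) * h (v # t)) = (\<Sum>v\<in>cofaces X ?\<tau>. c (v # t))"
        using w(1) by (intro sum.cong) (auto simp: h_def less_imp_neq[symmetric])
      also have "\<dots> = simplicial_boundary X c t"
        unfolding simplicial_boundary_def
      proof (rule sum.mono_neutral_left[OF simplicial_complexD(1)[OF X]])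
        show "\<forall>v\<in>\<Union>X - cofaces X ?\<tau>. c (v # t) = 0"
          using ordered_simplices_Suc[OF X, of _ t j] c(2) by (auto simp: n_def)
      qed (auto simp: cofaces_def)
      also have "\<dots> = 0" using cZ by (simp add: simplicial_cycles_def)
      finally have orth: "(\<Sum>v\<in>cofaces X ?\<tau>. w (insert v ?\<tau>) * h (v # t)) = 0" .
      have "mset (rep ?\<tau>) = mset t"
        using rep[OF \<tau>] t set_eq_iff_mset_eq_distinct[of "rep ?\<tau>" t] by (auto simp: ordered_simplices_def)
      \<comment> \<open>The common sign transfers the conditions from the chosen ordering of
        \<open>?\<tau>\<close> to \<open>t\<close>.\<close>
      then obtain \<epsilon> where \<epsilon>: "\<And>v. c (v # t) = \<epsilon> * c (v # rep ?\<tau>)"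
        using alternating_permute[OF c(1), of "rep ?\<tau>" t "[]"] by auto
      have "(\<Sum>v\<in>cofaces X ?\<tau>. \<phi> ?\<tau> i v * h (v # t)) = 0" if "i \<in> K ?\<tau>" for i
      proof -
        have "(\<Sum>v\<in>cofaces X ?\<tau>. \<phi> ?\<tau> i v * h (v # t)) = \<epsilon> * Q (?\<tau>, i) c"
          unfolding Q_def by (simp add: h_def \<epsilon> sum_distrib_left mult_ac)
        moreover have "Q (?\<tau>, i) c = 0"
          using that \<tau> vanish by (auto simp: \<Lambda>_def)
        ultimately show ?thesis by simp
      qed
      moreover note sep[of ?\<tau>, unfolded separates_def, THEN conjunct2, THEN conjunct2,
        THEN spec, of "\<lambda>v. h (v # t)"]
      ultimately show ?thesis
        using orth nz by blast
    qed
    show "c = 0"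
    proof (rule ccontr)
      assume "c \<noteq> 0"
      then obtain vs where vs: "c vs \<noteq> 0" by (auto simp: fun_eq_iff)
      then have mem: "vs \<in> ?O n" using c(2) by blast
      then obtain v t where vt: "vs = v # t"
        by (cases vs) (auto simp: ordered_simplices_def n_def)
      have t: "t \<in> ?O j" "v \<in> cofaces X (set t)"
        using mem ordered_simplices_Suc[OF X, of v t j] by (auto simp: vt n_def)
      have "h (v # t) \<noteq> 0"
        using vs w(1)[of "set vs"] by (simp add: h_def vt)
      \<comment> \<open>A nonzero \<open>c\<close> makes the gap strict at one \<open>t\<close>;
        where the link function vanishes, both sides are 0.\<close>
      have "(\<Sum>t\<in>?O j. \<alpha> * (\<Sum>v\<in>cofaces X (set t). w (insert v (set t)) * (h (v # t))\<^sup>2)) <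
          (\<Sum>t\<in>?O j. energy (set t) (\<lambda>v. h (v # t)))"
      proof (rule sum_strict_mono_ex1)
        show "\<forall>t\<in>?O j. \<alpha> * (\<Sum>v\<in>cofaces X (set t). w (insert v (set t)) * (h (v # t))\<^sup>2) \<le>
            energy (set t) (\<lambda>v. h (v # t))"
        proof
          fix t assume t: "t \<in> ?O j"
          show "\<alpha> * (\<Sum>v\<in>cofaces X (set t). w (insert v (set t)) * (h (v # t))\<^sup>2) \<le>
            energy (set t) (\<lambda>v. h (v # t))"
          proof (cases "\<exists>v\<in>cofaces X (set t). h (v # t) \<noteq> 0")
            case True
            then show ?thesis using gap[OF t] by simp
          next
            case False
            then show ?thesis by (simp add: energy_def)
          qed
        qed
        show "\<exists>t\<in>?O j. \<alpha> * (\<Sum>v\<in>cofaces X (set t). w (insert v (set t)) * (h (v # t))\<^sup>2) <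
            energy (set t) (\<lambda>v. h (v # t))"
          using gap[OF t(1)] t \<open>h (v # t) \<noteq> 0\<close> by blast
      qed (rule finite_ordered_simplices[OF X])
      \<comment> \<open>The Garland identity together with \<open>d\<close> \<le> \<open>w\<close>
        and \<alpha> \<ge> 0 bounds the total energy from the other side.\<close>
      also have "\<dots> \<le> \<alpha> * (\<Sum>t\<in>?O j. \<Sum>v\<in>cofaces X (set t). w (insert v (set t)) * (h (v # t))\<^sup>2)"
        unfolding energy_sum using w(2) \<alpha>(2)
        by (intro mult_left_mono sum_mono mult_right_mono) auto
      finally show False by (simp add: sum_distrib_left)
    qed
  qed
  also have "card \<Lambda> \<le> card \<beta> + (\<Sum>\<tau>\<in>?T. card (K \<tau>))"
  proof -
    have "card \<Lambda> \<le> card (P ` \<beta>) + card (Q ` Sigma ?T K)"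
      unfolding \<Lambda>_def by (rule card_Un_le)
    also have "\<dots> \<le> card \<beta> + card (Sigma ?T K)"
      using \<open>finite \<beta>\<close> \<open>finite ?T\<close> finK by (intro add_mono card_image_le finite_SigmaI) auto
    also have "card (Sigma ?T K) = (\<Sum>\<tau>\<in>?T. card (K \<tau>))"
      using \<open>finite ?T\<close> finK by (intro card_SigmaI) auto
    finally show ?thesis by simp
  qed
  finally have "int (real_vector.dim ?Z) \<le> int (real_vector.dim ?B) + (\<Sum>\<tau>\<in>?T. int (card (K \<tau>)))"
    unfolding \<beta>(4) by (simp flip: of_nat_sum)
  then show ?thesis
    using sep by (simp add: betti_def separates_def \<alpha>_def)
qed

end
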